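(* Let $G=(V,E)$ be a finite connected graph. The order of the torsion group $H^1\mathbf{D}(\mathrm{Cone}(\partial))\cong\mathrm{tors}\,\mathrm{Jac}(G)$ equals the number $\tau(G)$ of spanning trees of $G$. Equivalently, $$|\mathrm{tors}\,\mathrm{Jac}(G)|=|\mathrm{tors}\,\mathrm{coker}(L)|=\det L_{vv}=\tau(G),$$ where $L_{vv}$ is any reduced Laplacian, obtained from $L$ by deleting the row and column of a vertex $v$.
   Context: Fix an orientation of the edges; $C_0=\mathbb{Z}^V$, $C_1=\mathbb{Z}^E$, $\partial:C_1\to C_0$ is the boundary map and $L=\partial\partial^{\top}:\mathbb{Z}^V\to\mathbb{Z}^V$ is the combinatorial Laplacian. $\mathrm{Div}(G)=\mathbb{Z}^V$, $\mathrm{Prin}(G)=\operatorname{im}(L)$, $\mathrm{Jac}(G)=\mathrm{Div}(G)/\mathrm{Prin}(G)$. $\deg:C_0\to\mathbb{Z}$ is the sum of coordinates. $\mathrm{Cone}(\partial)$ denotes the three-term complex of free abelian groups $$C_1\xrightarrow{\binom{\partial}{0}}C_0\oplus\mathbb{Z}\xrightarrow{(\deg,-\mathrm{id})}\mathbb{Z},$$ with terms placed in cohomological degrees $-1,0,1$. $\mathbf{D}=\mathbf{R}\!\operatorname{Hom}_{\mathbb{Z}}(-,\mathbb{Z})$ on the bounded-below derived category of finitely generated abelian groups. $\mathrm{tors}$ denotes the torsion subgroup.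
   Formalization: H^1 D(Cone(∂)) is Z^E/im(∂^T), free of rank |E|-|V|+1 (Z for the triangle, where τ=3), so the first claim fails; the formal statement uses the same complex with L: Z^V→Z^V in place of ∂ and takes the torsion subgroup of its H^1. The displayed chain of equalities is unchanged. *)

theory Defs
  imports
    "HOL-Algebra.Product_Groups"
    "Graph_Theory.Digraph_Component"
    "Jordan_Normal_Form.Determinant"
begin

section \<open>Graphs and spanning trees\<close>

text \<open>
  A finite graph with a chosen orientation of its edges is a finite digraph \<open>G\<close>: the arcs are the
  edges, oriented from \<open>tail\<close> to \<open>head\<close>. Parallel edges and loops are allowed.
  The predicate \<open>connected\<close> of the digraph library is connectedness of the underlying undirected
  graph (and includes that there is a vertex). In contrast, the library's \<open>forest\<close>, \<open>tree\<close> and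
  \<open>spanning_tree\<close> refer to directed cycles, so acyclicity of the underlying graph is defined here.

  A pair \<open>(e, b)\<close> is the edge \<open>e\<close> traversed along its orientation (\<open>b = True\<close>) or against it. Since
  the edges of a cycle must be distinct, going back and forth along an edge is not a cycle,
  but a loop is one, and so are two parallel edges.
\<close>

definition step_start :: "('a, 'b) pre_digraph \<Rightarrow> 'b \<times> bool \<Rightarrow> 'a" where
  "step_start G s = (if snd s then tail G (fst s) else head G (fst s))"

definition step_end :: "('a, 'b) pre_digraph \<Rightarrow> 'b \<times> bool \<Rightarrow> 'a" where
  "step_end G s = (if snd s then head G (fst s) else tail G (fst s))"

definition undirected_cycle :: "('a, 'b) pre_digraph \<Rightarrow> ('b \<times> bool) list \<Rightarrow> bool" where
  "undirected_cycle G p \<longleftrightarrow>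
     p \<noteq> [] \<and> fst ` set p \<subseteq> arcs G \<and>
     distinct (map fst p) \<and> distinct (map (step_start G) p) \<and>
     (\<forall>i<length p. step_end G (p ! i) = step_start G (p ! (Suc i mod length p)))"

definition undirected_tree :: "('a, 'b) pre_digraph \<Rightarrow> bool" where
  "undirected_tree H \<longleftrightarrow> connected H \<and> \<not> (\<exists>p. undirected_cycle H p)"

definition num_spanning_trees :: "('a, 'b) pre_digraph \<Rightarrow> nat" where
  "num_spanning_trees G = card {H. spanning H G \<and> undirected_tree H}"


section \<open>Chains, boundary map and Laplacian\<close>

definition int_lattice :: "'s set \<Rightarrow> ('s \<Rightarrow> int) monoid" where
  "int_lattice S = product_group S (\<lambda>_. integer_group)"

definition basis_vec :: "'s set \<Rightarrow> 's \<Rightarrow> 's \<Rightarrow> int" where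
  "basis_vec S s = (\<lambda>t\<in>S. if t = s then 1 else 0)"

definition deg :: "'s set \<Rightarrow> ('s \<Rightarrow> int) \<Rightarrow> int" where
  "deg S x = (\<Sum>s\<in>S. x s)"

definition incidence :: "('a, 'b) pre_digraph \<Rightarrow> 'a \<Rightarrow> 'b \<Rightarrow> int" where
  "incidence G v e = (if v = head G e then 1 else 0) - (if v = tail G e then 1 else 0)"

definition boundary :: "('a, 'b) pre_digraph \<Rightarrow> ('b \<Rightarrow> int) \<Rightarrow> 'a \<Rightarrow> int" where
  "boundary G c = (\<lambda>v\<in>verts G. \<Sum>e\<in>arcs G. incidence G v e * c e)"

definition boundary_transpose :: "('a, 'b) pre_digraph \<Rightarrow> ('a \<Rightarrow> int) \<Rightarrow> 'b \<Rightarrow> int" where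
  "boundary_transpose G x = (\<lambda>e\<in>arcs G. \<Sum>v\<in>verts G. incidence G v e * x v)"

definition laplacian :: "('a, 'b) pre_digraph \<Rightarrow> ('a \<Rightarrow> int) \<Rightarrow> 'a \<Rightarrow> int" where
  "laplacian G x = boundary G (boundary_transpose G x)"

text \<open>
  The matrix of the Laplacian with respect to an enumeration \<open>vs\<close> of the vertices, and the matrix
  obtained by deleting the row and the column of the vertex \<open>vs ! i\<close>.
\<close>

definition laplacian_mat :: "('a, 'b) pre_digraph \<Rightarrow> 'a list \<Rightarrow> int mat" where
  "laplacian_mat G vs =
     mat (length vs) (length vs) (\<lambda>(i, j). laplacian G (basis_vec (verts G) (vs ! j)) (vs ! i))"

definition reduced_laplacian_mat :: "('a, 'b) pre_digraph \<Rightarrow> 'a list \<Rightarrow> nat \<Rightarrow> int mat" where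
  "reduced_laplacian_mat G vs i = mat_delete (laplacian_mat G vs) i i"


section \<open>Jacobian, cokernel and torsion\<close>

definition Div :: "('a, 'b) pre_digraph \<Rightarrow> ('a \<Rightarrow> int) monoid" where
  "Div G = int_lattice (verts G)"

definition Prin :: "('a, 'b) pre_digraph \<Rightarrow> ('a \<Rightarrow> int) set" where
  "Prin G = laplacian G ` carrier (int_lattice (verts G))"

definition Jac :: "('a, 'b) pre_digraph \<Rightarrow> ('a \<Rightarrow> int) set monoid" where
  "Jac G = Div G Mod Prin G"

definition coker :: "'x monoid \<Rightarrow> 'y monoid \<Rightarrow> ('x \<Rightarrow> 'y) \<Rightarrow> 'y set monoid" where
  "coker A B f = B Mod (f ` carrier A)"

definition tors :: "'x monoid \<Rightarrow> 'x monoid" where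
  "tors A = A\<lparr>carrier := {x \<in> carrier A. \<exists>n::nat. n > 0 \<and> x [^]\<^bsub>A\<^esub> n = \<one>\<^bsub>A\<^esub>}\<rparr>"


section \<open>Three-term complexes and duality\<close>

text \<open>Cochain complexes of abelian groups in degrees \<open>-1\<close>, \<open>0\<close>, \<open>1\<close>.\<close>

record ('x, 'y, 'z) complex3 =
  term_m1 :: "'x monoid"
  term_0 :: "'y monoid"
  term_1 :: "'z monoid"
  diff_m1 :: "'x \<Rightarrow> 'y"
  diff_0 :: "'y \<Rightarrow> 'z"

text \<open>There is no term in degree \<open>2\<close>, so every element of the term in degree \<open>1\<close> is a cocycle.\<close>

definition H1 :: "('x, 'y, 'z) complex3 \<Rightarrow> 'z set monoid" where
  "H1 K = term_1 K Mod (diff_0 K ` carrier (term_0 K))"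

definition dual_group :: "'x monoid \<Rightarrow> ('x \<Rightarrow> int) monoid" where
  "dual_group A =
     \<lparr>carrier = hom A integer_group \<inter> extensional (carrier A),
      monoid.mult = (\<lambda>f g. \<lambda>x\<in>carrier A. f x + g x),
      one = (\<lambda>x\<in>carrier A. 0)\<rparr>"

text \<open>
  \<open>RHom(-, \<int>)\<close> of a bounded complex of finitely generated free abelian groups is computed by the
  termwise dual complex; \<open>D\<close> is only applied to such complexes. Degrees are negated. The usual signs
  of the dual differentials are left out: they change neither kernels nor images.
\<close>

definition D :: "('x, 'y, 'z) complex3 \<Rightarrow> ('z \<Rightarrow> int, 'y \<Rightarrow> int, 'x \<Rightarrow> int) complex3" where
  "D K =
     \<lparr>term_m1 = dual_group (term_1 K),
      term_0 = dual_group (term_0 K),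
      term_1 = dual_group (term_m1 K),
      diff_m1 = (\<lambda>f. compose (carrier (term_0 K)) f (diff_0 K)),
      diff_0 = (\<lambda>f. compose (carrier (term_m1 K)) f (diff_m1 K))\<rparr>"

text \<open>
  For a homomorphism \<open>d\<close> from \<open>\<int>\<^sup>A\<close> to \<open>\<int>\<^sup>S\<close> whose image has degree \<open>0\<close>, this is the complex
  \<open>\<int>\<^sup>A \<rightarrow> \<int>\<^sup>S \<oplus> \<int> \<rightarrow> \<int>\<close> with maps \<open>(d, 0)\<close> and \<open>(deg, -id)\<close>.
\<close>

definition Cone ::
    "'r set \<Rightarrow> 's set \<Rightarrow> (('r \<Rightarrow> int) \<Rightarrow> ('s \<Rightarrow> int)) \<Rightarrow> ('r \<Rightarrow> int, ('s \<Rightarrow> int) \<times> int, int) complex3"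
  where
  "Cone A S d =
     \<lparr>term_m1 = int_lattice A,
      term_0 = int_lattice S \<times>\<times> integer_group,
      term_1 = integer_group,
      diff_m1 = (\<lambda>c. (d c, 0)),
      diff_0 = (\<lambda>(x, n). deg S x - n)\<rparr>"

text \<open>
  The two instances must not be confused. The group \<open>H1 (D (Cone_boundary G))\<close> is the cokernel of
  \<open>boundary_transpose\<close>, the first cohomology group of the graph; it is free for every connected
  graph, so it contains nothing of the torsion of \<open>Jac G\<close>. The group \<open>H1 (D (Cone_laplacian G))\<close> is
  the cokernel of the transpose of the Laplacian, and its torsion is that of \<open>Jac G\<close>.
\<close>

abbreviation Cone_boundary ::
    "('a, 'b) pre_digraph \<Rightarrow> ('b \<Rightarrow> int, ('a \<Rightarrow> int) \<times> int, int) complex3" where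
  "Cone_boundary G \<equiv> Cone (arcs G) (verts G) (boundary G)"

abbreviation Cone_laplacian ::
    "('a, 'b) pre_digraph \<Rightarrow> ('a \<Rightarrow> int, ('a \<Rightarrow> int) \<times> int, int) complex3" where
  "Cone_laplacian G \<equiv> Cone (verts G) (verts G) (laplacian G)"

end

theory Submission
  imports Defs
begin

text \<open>
  Two independent facts meet in the number \<open>det L\<^sub>v\<^sub>v\<close>. One is the matrix tree theorem, and the other is
  that a square integer matrix of nonzero determinant \<open>d\<close> has a cokernel with \<open>\<bar>d\<bar>\<close> elements.

  Matrix tree theorem. Fix a root \<open>r\<close>. The row of the reduced Laplacian at a vertex \<open>u \<noteq> r\<close> is a sum,
  over the steps (an edge with a direction of traversal) that leave \<open>u\<close>, of the differences between
  the unit vector at \<open>u\<close> and the one at the end of the step. Multilinearity turns the determinant into a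
  sum over all choices \<open>\<phi>\<close> of one outgoing step at every \<open>u \<noteq> r\<close>
  (\<open>det_principal_laplacian_mat\<close>). The summand is the determinant of \<open>I - P\<close>, where \<open>P\<close> is the
  adjacency matrix of the functional graph of \<open>\<phi>\<close>. If following \<open>\<phi>\<close> leads from every vertex to \<open>r\<close>,
  then \<open>I - P\<close> is unitriangular up to the order of the vertices and the summand is \<open>1\<close>; if not, the
  vertices that never reach \<open>r\<close> give a kernel vector and the summand is \<open>0\<close> (\<open>det_choice_mat\<close>).
  The choices of the first kind, called parent maps, are the spanning trees with all edges directed
  towards \<open>r\<close>, and forgetting the directions is a bijection onto the spanning trees
  (\<open>bij_betw_parent_maps_spanning_trees\<close>).

  Order of the torsion. The image of \<open>L\<close> consists of vectors of degree \<open>0\<close>, and \<open>L\<close> kills constants. A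
  vector of degree \<open>0\<close> is determined by its coordinates away from \<open>r\<close>, and in these coordinates the
  image of \<open>L\<close> is the column lattice of the reduced Laplacian. Since that matrix has nonzero
  determinant, a positive multiple of every vector of degree \<open>0\<close> lies in the image, so the torsion of the
  cokernel is exactly its degree \<open>0\<close> part, and a transversal of the column lattice lifts to a
  transversal of it (\<open>order_tors_coker_laplacian\<close>). A transversal with \<open>\<bar>det\<bar>\<close> elements is built by
  integer column operations (\<open>exists_transversal_card_det\<close>). Connectedness provides a
  spanning tree, which makes the determinant positive.

  Duality. The pairing identifies \<open>\<int>\<^sup>V\<close> with its dual group, and because \<open>L\<close> is self-adjoint it carries
  the image of \<open>L\<close> onto the coboundaries of the dual of the cone. Hence \<open>H\<^sup>1\<close> of that dual is isomorphic
  to the whole Jacobian (\<open>Jac_iso_H1_D_Cone_laplacian\<close>).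
\<close>

section \<open>Transversals of column lattices\<close>

text \<open>
  Representatives of \<open>\<int>\<^sup>n\<close> modulo the columns of \<open>A\<close>. The multipliers \<open>y\<close> are unique only when \<open>A\<close> is
  injective, so uniqueness is demanded of the representative alone.
\<close>

definition transversal :: "int mat \<Rightarrow> int vec set \<Rightarrow> bool" where
  "transversal A T \<longleftrightarrow>
     T \<subseteq> carrier_vec (dim_row A) \<and>
     (\<forall>x\<in>carrier_vec (dim_row A). \<exists>t\<in>T. \<exists>y\<in>carrier_vec (dim_col A). x = t + A *\<^sub>v y) \<and>
     (\<forall>t\<in>T. \<forall>t'\<in>T. \<forall>y\<in>carrier_vec (dim_col A). \<forall>y'\<in>carrier_vec (dim_col A).
        t + A *\<^sub>v y = t' + A *\<^sub>v y' \<longrightarrow> t = t')"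

lemma transversal_carrier: "transversal A T \<Longrightarrow> A \<in> carrier_mat n m \<Longrightarrow> T \<subseteq> carrier_vec n"
  unfolding transversal_def by auto

lemma transversal_exists:
  assumes "transversal A T" "A \<in> carrier_mat n m" "x \<in> carrier_vec n"
  obtains t y where "t \<in> T" "y \<in> carrier_vec m" "x = t + A *\<^sub>v y"
  using assms unfolding transversal_def by (metis carrier_matD)

lemma transversal_unique:
  assumes "transversal A T" "A \<in> carrier_mat n m" "t \<in> T" "t' \<in> T"
    "y \<in> carrier_vec m" "y' \<in> carrier_vec m" "t + A *\<^sub>v y = t' + A *\<^sub>v y'"
  shows "t = t'"
  using assms unfolding transversal_def by (metis carrier_matD(2))

lemma transversalI:
  assumes "A \<in> carrier_mat n m" "T \<subseteq> carrier_vec n"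
    "\<And>x. x \<in> carrier_vec n \<Longrightarrow> \<exists>t\<in>T. \<exists>y\<in>carrier_vec m. x = t + A *\<^sub>v y"
    "\<And>t t' y y'. t \<in> T \<Longrightarrow> t' \<in> T \<Longrightarrow> y \<in> carrier_vec m \<Longrightarrow> y' \<in> carrier_vec m \<Longrightarrow>
       t + A *\<^sub>v y = t' + A *\<^sub>v y' \<Longrightarrow> t = t'"
  shows "transversal A T"
proof -
  have "dim_row A = n" "dim_col A = m" using assms(1) by auto
  then show ?thesis unfolding transversal_def using assms(2-4) by metis
qed

text \<open>
  Every column of each matrix is an integer combination of columns of the other one, so the two column
  lattices are equal.
\<close>

lemma transversal_column_operation:
  assumes A: "A \<in> carrier_mat n m" and U: "U \<in> carrier_mat m m" and U': "U' \<in> carrier_mat m m"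
    and B: "B = A * U" and AB: "A = B * U'" and T: "transversal B T"
  shows "transversal A T"
proof -
  have Bc: "B \<in> carrier_mat n m" using A U B by simp
  have 1: "B *\<^sub>v y = A *\<^sub>v (U *\<^sub>v y)" if "y \<in> carrier_vec m" for y
    unfolding B using A U that by (rule assoc_mult_mat_vec)
  have 2: "A *\<^sub>v y = B *\<^sub>v (U' *\<^sub>v y)" if "y \<in> carrier_vec m" for y
    using assoc_mult_mat_vec[OF Bc U' that] AB by simp
  have "\<exists>t\<in>T. \<exists>y\<in>carrier_vec m. x = t + A *\<^sub>v y" if x: "x \<in> carrier_vec n" for x
  proof -
    obtain t y where "t \<in> T" "y \<in> carrier_vec m" "x = t + B *\<^sub>v y"
      using transversal_exists[OF T Bc x] by metis
    then show ?thesis using 1 U by (metis mult_mat_vec_carrier)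
  qed
  moreover have "t = t'" if "t \<in> T" "t' \<in> T" "y \<in> carrier_vec m" "y' \<in> carrier_vec m"
    "t + A *\<^sub>v y = t' + A *\<^sub>v y'" for t t' y y'
  proof -
    have "t + B *\<^sub>v (U' *\<^sub>v y) = t' + B *\<^sub>v (U' *\<^sub>v y')" using that 2 by simp
    then show ?thesis using transversal_unique[OF T Bc] that mult_mat_vec_carrier[OF U'] by blast
  qed
  ultimately show ?thesis using transversalI[OF A transversal_carrier[OF T Bc]] by blast
qed

lemma add_vec_right_cancel:
  fixes x y z :: "int vec"
  assumes eq: "x + z = y + z" and c: "x \<in> carrier_vec n" "y \<in> carrier_vec n" "z \<in> carrier_vec n"
  shows "x = y"
proof (rule eq_vecI)
  fix i assume "i < dim_vec y"
  then show "x $ i = y $ i" using arg_cong[OF eq, of "\<lambda>v. v $ i"] c by simp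
qed (use c in simp)

lemma append_vec1_eqD:
  assumes "u @\<^sub>v vec 1 (\<lambda>_. r) = u' @\<^sub>v vec 1 (\<lambda>_. r')" "u \<in> carrier_vec n" "u' \<in> carrier_vec n"
  shows "u = u' \<and> r = r'"
proof -
  have "u = u'" and v: "vec 1 (\<lambda>_. r) = vec 1 (\<lambda>_. r')" using append_vec_eq assms by blast+
  moreover have "r = r'" using arg_cong[OF v, of "\<lambda>v. v $ 0"] by simp
  ultimately show ?thesis by simp
qed

text \<open>
  Division with remainder by \<open>d\<close> in the last coordinate leaves a remainder in \<open>{0..<\<bar>d\<bar>}\<close> and fixes the
  multiple of the last column that has to be subtracted; what remains is the problem for \<open>A\<close>.
\<close>

lemma transversal_block:
  assumes A: "A \<in> carrier_mat n n" and b: "b \<in> carrier_mat n 1" and d: "d \<noteq> 0"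
    and T: "transversal A T"
  shows "transversal (four_block_mat A b (0\<^sub>m 1 n) (mat 1 1 (\<lambda>_. d)))
           ((\<lambda>(t, r). t @\<^sub>v vec 1 (\<lambda>_. r)) ` (T \<times> {0..<\<bar>d\<bar>}))"
    (is "transversal ?M ?S")
proof -
  have M: "?M \<in> carrier_mat (n + 1) (n + 1)" using A b by auto
  have Tc: "T \<subseteq> carrier_vec n" by (rule transversal_carrier[OF T A])
  have mult: "?M *\<^sub>v (y @\<^sub>v vec 1 (\<lambda>_. q)) =
      (A *\<^sub>v y + b *\<^sub>v vec 1 (\<lambda>_. q)) @\<^sub>v vec 1 (\<lambda>_. d * q)" if "y \<in> carrier_vec n" for y q
  proof -
    have "0\<^sub>m 1 n *\<^sub>v y + mat 1 1 (\<lambda>_. d) *\<^sub>v vec 1 (\<lambda>_. q) = vec 1 (\<lambda>_. d * q)"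
      using that by (intro eq_vecI) (auto simp: scalar_prod_def)
    then show ?thesis
      by (subst four_block_mat_mult_vec[OF A b _ _ that]) auto
  qed
  have split: "\<exists>u w. u \<in> carrier_vec n \<and> x = u @\<^sub>v vec 1 (\<lambda>_. w)"
    if "x \<in> carrier_vec (n + 1)" for x :: "int vec"
  proof (intro exI conjI)
    show "x = vec n (\<lambda>i. x $ i) @\<^sub>v vec 1 (\<lambda>_. x $ n)"
      using that by (intro eq_vecI) (auto simp: less_Suc_eq)
  qed auto
  have add: "(u @\<^sub>v vec 1 (\<lambda>_. w)) + (u' @\<^sub>v vec 1 (\<lambda>_. w')) = (u + u') @\<^sub>v vec 1 (\<lambda>_. w + w')"
    if "u \<in> carrier_vec n" "u' \<in> carrier_vec n" for u u' :: "int vec" and w w'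
    using that by (intro eq_vecI) auto
  have "\<exists>s\<in>?S. \<exists>y\<in>carrier_vec (n + 1). x = s + ?M *\<^sub>v y" if xc: "x \<in> carrier_vec (n + 1)" for x
  proof -
    obtain u w where u: "u \<in> carrier_vec n" and x: "x = u @\<^sub>v vec 1 (\<lambda>_. w)" using split[OF xc] by blast
    \<comment> \<open>the sign of \<open>d\<close> goes into the quotient, so that the remainder is nonnegative\<close>
    define r where "r = w mod \<bar>d\<bar>"
    define q where "q = sgn d * (w div \<bar>d\<bar>)"
    have r: "r \<in> {0..<\<bar>d\<bar>}" using d unfolding r_def by auto
    have "d * q = \<bar>d\<bar> * (w div \<bar>d\<bar>)" unfolding q_def by (simp add: abs_sgn)
    then have w: "w = r + d * q" unfolding r_def by simp
    have bq: "b *\<^sub>v vec 1 (\<lambda>_. q) \<in> carrier_vec n" using b by auto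
    obtain t y where t: "t \<in> T" and y: "y \<in> carrier_vec n" and ty: "u - b *\<^sub>v vec 1 (\<lambda>_. q) = t + A *\<^sub>v y"
      using transversal_exists[OF T A, of "u - b *\<^sub>v vec 1 (\<lambda>_. q)"] u bq by auto
    have tc: "t \<in> carrier_vec n" using t Tc by auto
    have Ay: "A *\<^sub>v y \<in> carrier_vec n" using A y by auto
    have "u = t + (A *\<^sub>v y + b *\<^sub>v vec 1 (\<lambda>_. q))"
    proof -
      have "u = (u - z) + z" if "z \<in> carrier_vec n" for z using u that by (intro eq_vecI) auto
      from this[OF bq] have "u = (u - b *\<^sub>v vec 1 (\<lambda>_. q)) + b *\<^sub>v vec 1 (\<lambda>_. q)" .
      then show ?thesis unfolding ty using tc Ay bq by (simp add: assoc_add_vec[of _ n])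
    qed
    then have "x = (t @\<^sub>v vec 1 (\<lambda>_. r)) + ?M *\<^sub>v (y @\<^sub>v vec 1 (\<lambda>_. q))"
      unfolding mult[OF y] x using w tc Ay bq by (subst add) auto
    moreover have "t @\<^sub>v vec 1 (\<lambda>_. r) \<in> ?S" using t r by force
    moreover have "y @\<^sub>v vec 1 (\<lambda>_. q) \<in> carrier_vec (n + 1)" using y by (intro carrier_vecI) simp
    ultimately show ?thesis by blast
  qed
  moreover have "s = s'" if mem: "s \<in> ?S" "s' \<in> ?S" "y \<in> carrier_vec (n + 1)" "y' \<in> carrier_vec (n + 1)"
    and eq: "s + ?M *\<^sub>v y = s' + ?M *\<^sub>v y'" for s s' y y'
  proof -
    obtain t r where t: "t \<in> T" and r: "r \<in> {0..<\<bar>d\<bar>}" and s: "s = t @\<^sub>v vec 1 (\<lambda>_. r)"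
      using mem(1) by auto
    obtain t' r' where t': "t' \<in> T" and r': "r' \<in> {0..<\<bar>d\<bar>}" and s': "s' = t' @\<^sub>v vec 1 (\<lambda>_. r')"
      using mem(2) by auto
    obtain u q where u: "u \<in> carrier_vec n" and y: "y = u @\<^sub>v vec 1 (\<lambda>_. q)" using split[OF mem(3)] by blast
    obtain u' q' where u': "u' \<in> carrier_vec n" and y': "y' = u' @\<^sub>v vec 1 (\<lambda>_. q')"
      using split[OF mem(4)] by blast
    have tc: "t \<in> carrier_vec n" "t' \<in> carrier_vec n" using t t' Tc by auto
    have Ac: "A *\<^sub>v u \<in> carrier_vec n" "A *\<^sub>v u' \<in> carrier_vec n" using A u u' by auto
    have bc: "b *\<^sub>v vec 1 (\<lambda>_. q) \<in> carrier_vec n" for q using b by auto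
    have "(t + (A *\<^sub>v u + b *\<^sub>v vec 1 (\<lambda>_. q))) @\<^sub>v vec 1 (\<lambda>_. r + d * q) =
          (t' + (A *\<^sub>v u' + b *\<^sub>v vec 1 (\<lambda>_. q'))) @\<^sub>v vec 1 (\<lambda>_. r' + d * q')"
      using eq unfolding s s' y y' mult[OF u] mult[OF u']
        add[OF tc(1) add_carrier_vec[OF Ac(1) bc]] add[OF tc(2) add_carrier_vec[OF Ac(2) bc]] .
    then have 1: "t + (A *\<^sub>v u + b *\<^sub>v vec 1 (\<lambda>_. q)) = t' + (A *\<^sub>v u' + b *\<^sub>v vec 1 (\<lambda>_. q'))"
      and 2: "r + d * q = r' + d * q'"
      using append_vec1_eqD[of _ _ _ _ n] tc Ac bc by (metis add_carrier_vec)+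
    have "r = (r + d * q) mod \<bar>d\<bar>" using r by (simp add: mod_add_eq[symmetric])
    also have "\<dots> = r'" unfolding 2 using r' by (simp add: mod_add_eq[symmetric])
    finally have rr: "r = r'" .
    with 2 d have qq: "q = q'" by simp
    have "t + A *\<^sub>v u + b *\<^sub>v vec 1 (\<lambda>_. q') = t' + A *\<^sub>v u' + b *\<^sub>v vec 1 (\<lambda>_. q')"
      using 1 qq tc Ac bc by (simp add: assoc_add_vec[of _ n])
    then have "t + A *\<^sub>v u = t' + A *\<^sub>v u'"
      by (rule add_vec_right_cancel) (use tc Ac bc in auto)
    then have "t = t'" by (rule transversal_unique[OF T A t t' u u'])
    then show ?thesis using s s' rr by simp
  qed
  moreover have "?S \<subseteq> carrier_vec (n + 1)" using Tc by (auto intro!: carrier_vecI dest!: subsetD)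
  ultimately show ?thesis using transversalI[OF M] by blast
qed

text \<open>
  Euclid's algorithm on the entries of the last row: adding a column to another one, with the right
  sign, lowers the sum of the absolute values as long as two entries are nonzero. When a single
  nonzero entry remains, it is moved to the corner, which gives the block form of
  \<open>transversal_block\<close> and the factorisation of the determinant at the same time.
\<close>

lemma exists_transversal_card_det:
  assumes "A \<in> carrier_mat n n" "det A \<noteq> 0"
  shows "\<exists>T. finite T \<and> card T = nat \<bar>det A\<bar> \<and> transversal A T"
  using assms
proof (induction n arbitrary: A)
  case 0
  then have "det A = 1" by simp
  moreover have "transversal A {0\<^sub>v 0}"
  proof (rule transversalI[OF 0(1)])
    show "\<exists>t\<in>{0\<^sub>v 0}. \<exists>y\<in>carrier_vec 0. x = t + A *\<^sub>v y" if "x \<in> carrier_vec 0" for x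
      using that 0(1) by (intro bexI[of _ "0\<^sub>v 0"] eq_vecI) auto
  qed auto
  ultimately show ?case by (intro exI[of _ "{0\<^sub>v 0}"]) auto
next
  case (Suc n)
  define P where "P B \<longleftrightarrow> (\<exists>T. finite T \<and> card T = nat \<bar>det B\<bar> \<and> transversal B T)" for B :: "int mat"
  have pivot: "P B" if B: "B \<in> carrier_mat (Suc n) (Suc n)" "det B \<noteq> 0"
    and z: "\<And>j. j < n \<Longrightarrow> B $$ (n, j) = 0" for B
  proof -
    define B' where "B' = mat n n (\<lambda>(i, j). B $$ (i, j))"
    define b where "b = mat n 1 (\<lambda>(i, j). B $$ (i, n))"
    define d where "d = B $$ (n, n)"
    have c: "B' \<in> carrier_mat n n" "b \<in> carrier_mat n 1" by (auto simp: B'_def b_def)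
    have eq: "B = four_block_mat B' b (0\<^sub>m 1 n) (mat 1 1 (\<lambda>_. d))"
      using B z by (intro eq_matI) (auto simp: B'_def b_def d_def less_Suc_eq not_less)
    have "det (mat 1 1 (\<lambda>_. d)) = d" by (subst det_single) auto
    then have det: "det B = det B' * d"
      unfolding eq using det_four_block_mat_lower_left_zero[OF c(1) c(2) refl, of "mat 1 1 (\<lambda>_. d)"] by simp
    then obtain T where T: "finite T" "card T = nat \<bar>det B'\<bar>" "transversal B' T"
      using Suc.IH[OF c(1)] B by auto
    have d0: "d \<noteq> 0" using det B by auto
    let ?S = "(\<lambda>(t, r). t @\<^sub>v vec 1 (\<lambda>_. r)) ` (T \<times> {0..<\<bar>d\<bar>})"
    have Tc: "T \<subseteq> carrier_vec n" by (rule transversal_carrier[OF T(3) c(1)])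
    have "inj_on (\<lambda>(t, r). t @\<^sub>v vec 1 (\<lambda>_. r)) (T \<times> {0..<\<bar>d\<bar>})"
    proof (rule inj_onI, clarify)
      fix t r t' r' assume "t \<in> T" "t' \<in> T"
        and e: "t @\<^sub>v vec 1 (\<lambda>_. r) = t' @\<^sub>v vec 1 (\<lambda>_. r'::int)"
      then have "t \<in> carrier_vec n" "t' \<in> carrier_vec n" using Tc by auto
      then show "t = t' \<and> r = r'" using append_vec1_eqD[OF e] by blast
    qed
    then have "card ?S = card (T \<times> {0..<\<bar>d\<bar>})" by (rule card_image)
    also have "\<dots> = nat \<bar>det B\<bar>" using T by (simp add: card_cartesian_product det abs_mult nat_mult_distrib)
    finally have "card ?S = nat \<bar>det B\<bar>" .
    moreover have "transversal B ?S" unfolding eq by (rule transversal_block[OF c d0 T(3)])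
    ultimately show ?thesis unfolding P_def using T by (intro exI[of _ ?S]) auto
  qed
  have "P B" if "B \<in> carrier_mat (Suc n) (Suc n)" "det B \<noteq> 0" for B
    using that
  proof (induction "nat (\<Sum>j<Suc n. \<bar>B $$ (n, j)\<bar>)" arbitrary: B rule: less_induct)
    case less
    note B = less.prems
    show ?case
    proof (cases "\<exists>j k. j < Suc n \<and> k < Suc n \<and> j \<noteq> k \<and> B $$ (n, j) \<noteq> 0 \<and> B $$ (n, k) \<noteq> 0 \<and>
                    \<bar>B $$ (n, j)\<bar> \<le> \<bar>B $$ (n, k)\<bar>")
      case True
      then obtain j k where jk: "j < Suc n" "k < Suc n" "j \<noteq> k" "B $$ (n, j) \<noteq> 0" "B $$ (n, k) \<noteq> 0"
        "\<bar>B $$ (n, j)\<bar> \<le> \<bar>B $$ (n, k)\<bar>" by blast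
      \<comment> \<open>with this sign \<open>\<bar>s * B\<^sub>n\<^sub>j + B\<^sub>n\<^sub>k\<bar> = \<bar>B\<^sub>n\<^sub>k\<bar> - \<bar>B\<^sub>n\<^sub>j\<bar>\<close>\<close>
      define s where "s = - sgn (B $$ (n, j)) * sgn (B $$ (n, k))"
      define C where "C = addcol s k j B"
      have C: "C \<in> carrier_mat (Suc n) (Suc n)" using B unfolding C_def mat_addcol_def by auto
      have det: "det C = det B" unfolding C_def by (rule det_addcol[OF jk(1) jk(3)[symmetric] B(1)])
      have "\<bar>s * B $$ (n, j) + B $$ (n, k)\<bar> < \<bar>B $$ (n, k)\<bar>"
        using jk unfolding s_def by (cases "B $$ (n, j) > 0"; cases "B $$ (n, k) > 0") (simp_all add: sgn_if)
      then have lt: "\<bar>C $$ (n, k)\<bar> < \<bar>B $$ (n, k)\<bar>" using B jk unfolding C_def by simp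
      have same: "C $$ (n, l) = B $$ (n, l)" if "l < Suc n" "l \<noteq> k" for l
        using that B unfolding C_def by auto
      have "(\<Sum>l<Suc n. \<bar>C $$ (n, l)\<bar>) < (\<Sum>l<Suc n. \<bar>B $$ (n, l)\<bar>)"
      proof (rule sum_strict_mono_ex1)
        show "\<forall>l\<in>{..<Suc n}. \<bar>C $$ (n, l)\<bar> \<le> \<bar>B $$ (n, l)\<bar>" using lt same by (metis lessThan_iff order.refl order_less_imp_le)
        show "\<exists>l\<in>{..<Suc n}. \<bar>C $$ (n, l)\<bar> < \<bar>B $$ (n, l)\<bar>" using lt jk by blast
      qed simp
      moreover have "0 \<le> (\<Sum>l<Suc n. \<bar>C $$ (n, l)\<bar>)" by (rule sum_nonneg) simp
      ultimately have "nat (\<Sum>l<Suc n. \<bar>C $$ (n, l)\<bar>) < nat (\<Sum>l<Suc n. \<bar>B $$ (n, l)\<bar>)" by linarith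
      then have "P C" using less.hyps C det B by auto
      moreover have "transversal B T" if "transversal C T" for T
      proof (rule transversal_column_operation[OF B(1) _ _ _ _ that])
        show "C = B * addrow_mat (Suc n) s j k" unfolding C_def by (rule addcol_mat[OF B(1) jk(1)])
        have "B = addcol (- s) k j C"
          using B jk unfolding C_def by (intro eq_matI) (auto simp: mat_addcol_def)
        then show "B = C * addrow_mat (Suc n) (- s) j k" using addcol_mat[OF C jk(1)] by simp
      qed auto
      ultimately show ?thesis unfolding P_def det by blast
    next
      case False
      have "\<exists>j<Suc n. B $$ (n, j) \<noteq> 0"
      proof (rule ccontr)
        assume "\<not> ?thesis"
        then have "(\<Sum>j<Suc n. B $$ (n, j) * cofactor B n j) = 0" by (intro sum.neutral) auto
        then show False using laplace_expansion_row[OF B(1), of n] B(2) by simp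
      qed
      then obtain p where p: "p < Suc n" "B $$ (n, p) \<noteq> 0" by blast
      have z: "B $$ (n, j) = 0" if "j < Suc n" "j \<noteq> p" for j
        using False p that by (metis linear)
      show ?thesis
      proof (cases "p = n")
        case True
        then show ?thesis using pivot[OF B] z by simp
      next
        case False
        define C where "C = swapcols p n B"
        have C: "C \<in> carrier_mat (Suc n) (Suc n)" using B unfolding C_def by auto
        have det: "det C = - det B" unfolding C_def by (rule det_swapcols[OF p(1) _ False B(1)]) simp
        have "P C"
        proof (rule pivot[OF C])
          show "det C \<noteq> 0" using det B by simp
          show "C $$ (n, j) = 0" if "j < n" for j
            using that B p z False unfolding C_def by auto
        qed
        moreover have "transversal B T" if "transversal C T" for T
        proof (rule transversal_column_operation[OF B(1) _ _ _ _ that])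
          show "C = B * swaprows_mat (Suc n) p n" unfolding C_def by (rule swapcols_mat[OF B(1) p(1)]) simp
          have "B = swapcols p n C"
            using B p unfolding C_def by (intro eq_matI) (auto simp: mat_swapcols_def)
          then show "B = C * swaprows_mat (Suc n) p n" using swapcols_mat[OF C p(1)] by simp
        qed auto
        ultimately show ?thesis unfolding P_def det by auto
      qed
    qed
  qed
  then show ?case using Suc.prems unfolding P_def by blast
qed

section \<open>Walks and undirected cycles\<close>

lemma step_ends_same_edge:
  assumes "fst s = fst t"
  shows "step_start G s = step_start G t \<and> step_end G s = step_end G t \<or>
         step_start G s = step_end G t \<and> step_end G s = step_start G t"
  using assms by (auto simp: step_start_def step_end_def)

fun walk :: "('a, 'b) pre_digraph \<Rightarrow> 'a \<Rightarrow> ('b \<times> bool) list \<Rightarrow> 'a \<Rightarrow> bool" where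
  "walk G a [] b \<longleftrightarrow> a = b"
| "walk G a (s # p) b \<longleftrightarrow> step_start G s = a \<and> walk G (step_end G s) p b"

lemma walk_append: "walk G a (p @ q) b \<longleftrightarrow> (\<exists>c. walk G a p c \<and> walk G c q b)"
  by (induction p arbitrary: a) auto

lemma walk_step_end:
  "walk G a p b \<Longrightarrow> t \<in> set p \<Longrightarrow> step_end G t \<in> step_start G ` set p \<or> step_end G t = b"
proof (induction p arbitrary: a)
  case (Cons s p)
  show ?case
  proof (cases "t = s")
    case True
    then show ?thesis using Cons.prems by (cases p) auto
  next
    case False
    then show ?thesis using Cons by auto
  qed
qed simp

lemma walk_nth:
  "walk G a p b \<Longrightarrow> i < length p \<Longrightarrow>
   step_end G (p ! i) = (if Suc i < length p then step_start G (p ! Suc i) else b)"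
proof (induction p arbitrary: a i)
  case (Cons s p)
  show ?case
  proof (cases i)
    case 0
    then show ?thesis using Cons.prems by (cases p) auto
  next
    case (Suc k)
    then show ?thesis using Cons by auto
  qed
qed simp

definition step_rel :: "('a, 'b) pre_digraph \<Rightarrow> 'b set \<Rightarrow> 'a rel" where
  "step_rel G F = (\<lambda>s. (step_start G s, step_end G s)) ` (F \<times> UNIV)"

lemma sym_step_rel: "sym (step_rel G F)"
proof (rule symI)
  fix a b assume "(a, b) \<in> step_rel G F"
  then obtain e d where "e \<in> F" "a = step_start G (e, d)" "b = step_end G (e, d)"
    unfolding step_rel_def by auto
  then have "(b, a) = (step_start G (e, \<not> d), step_end G (e, \<not> d))" "(e, \<not> d) \<in> F \<times> UNIV"
    by (auto simp: step_start_def step_end_def)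
  then show "(b, a) \<in> step_rel G F" unfolding step_rel_def by blast
qed

text \<open>
  Prepend the first step to a simple walk for the rest; if its start is already on that walk, the
  part of the walk from there on is the one wanted.
\<close>

lemma exists_simple_walk:
  assumes "(a, b) \<in> (step_rel G F)\<^sup>*"
  shows "\<exists>p. walk G a p b \<and> fst ` set p \<subseteq> F \<and> distinct (map (step_start G) p) \<and> b \<notin> step_start G ` set p"
  using assms
proof (induction rule: converse_rtrancl_induct)
  case base
  show ?case by (intro exI[of _ "[]"]) simp
next
  case (step a c)
  obtain s where s: "fst s \<in> F" "step_start G s = a" "step_end G s = c"
    using step.hyps(1) unfolding step_rel_def by auto
  obtain p where p: "walk G c p b" "fst ` set p \<subseteq> F" "distinct (map (step_start G) p)"
    "b \<notin> step_start G ` set p" using step.IH by blast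
  consider "a = b" | "a \<in> step_start G ` set p" | "a \<noteq> b" "a \<notin> step_start G ` set p" by blast
  then show ?case
  proof cases
    case 1
    then show ?thesis by (intro exI[of _ "[]"]) simp
  next
    case 2
    then obtain t where t: "t \<in> set p" "a = step_start G t" by blast
    obtain p1 p2 where "p = p1 @ t # p2" using t(1) split_list by fast
    then show ?thesis using p t by (intro exI[of _ "t # p2"]) (auto simp: walk_append)
  next
    case 3
    then show ?thesis using p s by (intro exI[of _ "s # p"]) auto
  qed
qed

text \<open>
  An edge that is used again brings the walk back to the start of its first use. Here it matters that
  the end \<open>b\<close> is not the start of a step: otherwise the walk could go back and forth along one edge.
\<close>

lemma simple_walk_distinct_edges:
  "walk G a p b \<Longrightarrow> distinct (map (step_start G) p) \<Longrightarrow> b \<notin> step_start G ` set p \<Longrightarrow> distinct (map fst p)"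
proof (induction p arbitrary: a)
  case (Cons s p)
  have "fst s \<notin> fst ` set p"
  proof
    assume "fst s \<in> fst ` set p"
    then obtain t where t: "t \<in> set p" "fst s = fst t" by auto
    have "step_start G s \<noteq> step_start G t" using t Cons.prems(2) by auto
    then have "step_end G t = step_start G s" using step_ends_same_edge[OF t(2), of G] by auto
    then have "step_start G s \<in> step_start G ` set p \<or> step_start G s = b"
      using walk_step_end[of G _ p b t] t Cons.prems(1) by auto
    then show False using Cons.prems by auto
  qed
  then show ?case using Cons by auto
qed simp

text \<open>
  The cycle is \<open>e\<close> followed by a simple walk inside \<open>F\<close> from its head back to its tail. For a loop that
  walk is empty.
\<close>

lemma undirected_cycle_if_connected_without_edge:
  assumes e: "e \<in> arcs H" "e \<notin> F" and F: "F \<subseteq> arcs H"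
    and conn: "(head H e, tail H e) \<in> (step_rel H F)\<^sup>*"
  shows "\<exists>p. undirected_cycle H p"
proof -
  obtain q where q: "walk H (head H e) q (tail H e)" "fst ` set q \<subseteq> F" "distinct (map (step_start H) q)"
    "tail H e \<notin> step_start H ` set q" using exists_simple_walk[OF conn] by blast
  define p where "p = (e, True) # q"
  have w: "walk H (tail H e) p (tail H e)" using q by (simp add: p_def step_start_def step_end_def)
  have "step_end H (p ! i) = step_start H (p ! (Suc i mod length p))" if i: "i < length p" for i
  proof (cases "Suc i < length p")
    case True
    then show ?thesis using walk_nth[OF w i] by simp
  next
    case False
    then have "Suc i = length p" using i by simp
    then show ?thesis using walk_nth[OF w i] by (simp add: p_def step_start_def)
  qed
  moreover have "distinct (map fst p)"
    using simple_walk_distinct_edges[OF q(1,3,4)] q(2) e unfolding p_def by auto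
  moreover have "distinct (map (step_start H) p)" using q(3,4) by (auto simp: p_def step_start_def)
  ultimately show ?thesis unfolding undirected_cycle_def using e q(2) F
    by (intro exI[of _ p]) (auto simp: p_def)
qed

lemma connected_iff_step_rel:
  assumes "wf_digraph H"
  shows "connected H \<longleftrightarrow> verts H \<noteq> {} \<and> (\<forall>u\<in>verts H. \<forall>v\<in>verts H. (u, v) \<in> (step_rel H (arcs H))\<^sup>*)"
proof -
  have eq: "parcs (mk_symmetric H) = step_rel H (arcs H)"
  proof -
    have "step_rel H (arcs H) =
        (\<Union>e\<in>arcs H. {(step_start H (e, True), step_end H (e, True)), (step_start H (e, False), step_end H (e, False))})"
      unfolding step_rel_def by (auto simp: UNIV_bool)
    then show ?thesis unfolding parcs_mk_symmetric by (simp add: step_start_def step_end_def)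
  qed
  have sub: "step_rel H (arcs H) \<subseteq> verts H \<times> verts H"
    using assms unfolding wf_digraph_def step_rel_def step_start_def step_end_def by auto
  have "(u, v) \<in> rtrancl_on (verts H) (step_rel H (arcs H)) \<longleftrightarrow> (u, v) \<in> (step_rel H (arcs H))\<^sup>*"
    if "u \<in> verts H" for u v
  proof
    assume "(u, v) \<in> (step_rel H (arcs H))\<^sup>*"
    then show "(u, v) \<in> rtrancl_on (verts H) (step_rel H (arcs H))"
      using that sub by (induction rule: rtrancl_induct) (auto intro: rtrancl_on_into_rtrancl_on)
  qed (rule rtrancl_on_rtranclI)
  then show ?thesis
    unfolding connected_def strongly_connected_def reachable_def using eq by simp
qed

section \<open>Parent maps and spanning trees\<close>

text \<open>
  Parents lie below their children. Well-foundedness of this relation says that following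
  \<open>\<phi>\<close> reaches the root \<open>r\<close> from every vertex, and its induction rule is induction along the branches
  of the tree.
\<close>

definition parent_rel :: "('a, 'b) pre_digraph \<Rightarrow> 'a \<Rightarrow> ('a \<Rightarrow> 'b \<times> bool) \<Rightarrow> 'a rel" where
  "parent_rel G r \<phi> = (\<lambda>u. (step_end G (\<phi> u), u)) ` (verts G - {r})"

definition step_choices :: "('a, 'b) pre_digraph \<Rightarrow> 'a \<Rightarrow> ('a \<Rightarrow> 'b \<times> bool) set" where
  "step_choices G r = (\<Pi>\<^sub>E u\<in>verts G - {r}. {s \<in> arcs G \<times> UNIV. step_start G s = u})"

definition parent_maps :: "('a, 'b) pre_digraph \<Rightarrow> 'a \<Rightarrow> ('a \<Rightarrow> 'b \<times> bool) set" where
  "parent_maps G r = {\<phi> \<in> step_choices G r. wf (parent_rel G r \<phi>)}"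

definition edges_of :: "('a, 'b) pre_digraph \<Rightarrow> 'a \<Rightarrow> ('a \<Rightarrow> 'b \<times> bool) \<Rightarrow> 'b set" where
  "edges_of G r \<phi> = (\<lambda>u. fst (\<phi> u)) ` (verts G - {r})"

text \<open>
  Spanning subgraphs are determined by their edges, so trees can be compared through edge sets.
\<close>

definition spanning_subgraph :: "('a, 'b) pre_digraph \<Rightarrow> 'b set \<Rightarrow> ('a, 'b) pre_digraph" where
  "spanning_subgraph G F = \<lparr>verts = verts G, arcs = F, tail = tail G, head = head G\<rparr>"

lemma spanning_subgraph_sel [simp]:
  "verts (spanning_subgraph G F) = verts G" "arcs (spanning_subgraph G F) = F"
  "step_start (spanning_subgraph G F) = step_start G" "step_end (spanning_subgraph G F) = step_end G"
  "tail (spanning_subgraph G F) = tail G" "head (spanning_subgraph G F) = head G"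
  by (auto simp: spanning_subgraph_def step_start_def step_end_def fun_eq_iff)

lemma step_rel_spanning_subgraph [simp]: "step_rel (spanning_subgraph G F) = step_rel G"
  by (simp add: step_rel_def fun_eq_iff)

lemma spanning_iff:
  assumes "wf_digraph G"
  shows "spanning H G \<longleftrightarrow> (\<exists>F\<subseteq>arcs G. H = spanning_subgraph G F)"
proof
  assume H: "spanning H G"
  then have "H = spanning_subgraph G (arcs H)" "arcs H \<subseteq> arcs G"
    unfolding spanning_def subgraph_def compatible_def spanning_subgraph_def by auto
  then show "\<exists>F\<subseteq>arcs G. H = spanning_subgraph G F" by blast
next
  assume "\<exists>F\<subseteq>arcs G. H = spanning_subgraph G F"
  then obtain F where F: "F \<subseteq> arcs G" and H: "H = spanning_subgraph G F" by blast
  have "wf_digraph H" using assms F unfolding H wf_digraph_def by auto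
  then show "spanning H G" using assms F unfolding H spanning_def subgraph_def compatible_def by simp
qed

lemma step_in_verts:
  assumes "wf_digraph G" "fst s \<in> arcs G"
  shows "step_start G s \<in> verts G" "step_end G s \<in> verts G"
  using assms unfolding wf_digraph_def step_start_def step_end_def by auto

lemma step_choicesD:
  assumes "\<phi> \<in> step_choices G r" "u \<in> verts G" "u \<noteq> r"
  shows "fst (\<phi> u) \<in> arcs G" "step_start G (\<phi> u) = u"
proof -
  have "\<phi> u \<in> {s \<in> arcs G \<times> UNIV. step_start G s = u}"
    using PiE_mem[OF assms(1)[unfolded step_choices_def], of u] assms(2,3) by simp
  then show "fst (\<phi> u) \<in> arcs G" "step_start G (\<phi> u) = u" by auto
qed

lemma finite_step_choices:
  assumes "fin_digraph G"
  shows "finite (step_choices G r)"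
proof -
  interpret fin_digraph G by fact
  have "finite {s \<in> arcs G \<times> UNIV. step_start G s = u}" for u
    by (rule finite_subset[of _ "arcs G \<times> UNIV"]) auto
  then show ?thesis unfolding step_choices_def by (intro finite_PiE) auto
qed

lemma edges_of_subset: "\<phi> \<in> step_choices G r \<Longrightarrow> edges_of G r \<phi> \<subseteq> arcs G"
  unfolding edges_of_def by (auto intro: step_choicesD(1))

lemma parent_map_connects:
  assumes G: "wf_digraph G" and \<phi>: "\<phi> \<in> parent_maps G r"
    and u: "u \<in> verts G" and v: "v \<in> verts G"
  shows "(u, v) \<in> (step_rel G (edges_of G r \<phi>))\<^sup>*"
proof -
  let ?E = "step_rel G (edges_of G r \<phi>)"
  have c: "\<phi> \<in> step_choices G r" and w: "wf (parent_rel G r \<phi>)" using \<phi> unfolding parent_maps_def by auto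
  have root: "(x, r) \<in> ?E\<^sup>*" if "x \<in> verts G" for x
    using w that
  proof (induction x rule: wf_induct_rule)
    case (less x)
    show ?case
    proof (cases "x = r")
      case False
      let ?y = "step_end G (\<phi> x)"
      have "(?y, x) \<in> parent_rel G r \<phi>" using False less.prems unfolding parent_rel_def by auto
      moreover have "?y \<in> verts G" using step_in_verts[OF G step_choicesD(1)[OF c less.prems False]] by blast
      ultimately have "(?y, r) \<in> ?E\<^sup>*" using less.IH by blast
      moreover have "(x, ?y) \<in> ?E"
      proof -
        have "\<phi> x \<in> edges_of G r \<phi> \<times> UNIV" using False less.prems unfolding edges_of_def by (auto simp: mem_Times_iff)
        then have "(step_start G (\<phi> x), ?y) \<in> ?E" unfolding step_rel_def by (rule imageI)
        then show ?thesis using step_choicesD(2)[OF c less.prems False] by simp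
      qed
      ultimately show ?thesis by (rule converse_rtrancl_into_rtrancl[rotated])
    qed simp
  qed
  have "sym (?E\<^sup>*)" by (rule sym_rtrancl[OF sym_step_rel])
  then have "(r, v) \<in> ?E\<^sup>*" using root[OF v] by (auto dest: symD)
  with root[OF u] show ?thesis by (rule rtrancl_trans)
qed

text \<open>
  An edge chosen by \<open>\<phi>\<close> is the parent edge of one of its two ends, and then the other end is the
  parent.
\<close>

lemma edge_of_parent_mapE:
  assumes c: "\<phi> \<in> step_choices G r" and e: "fst s \<in> edges_of G r \<phi>"
  obtains x where "x \<in> verts G - {r}" "fst s = fst (\<phi> x)" "x = step_start G s" "step_end G (\<phi> x) = step_end G s"
  | x where "x \<in> verts G - {r}" "fst s = fst (\<phi> x)" "x = step_end G s" "step_end G (\<phi> x) = step_start G s"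
proof -
  obtain x where x: "x \<in> verts G - {r}" "fst s = fst (\<phi> x)" using e unfolding edges_of_def by auto
  have sx: "step_start G (\<phi> x) = x" using step_choicesD(2)[OF c] x by auto
  show thesis using step_ends_same_edge[OF x(2), of G] unfolding sx
  proof (elim disjE conjE)
    assume "step_start G s = x" "step_end G s = step_end G (\<phi> x)"
    then show thesis using that(1)[OF x] by simp
  next
    assume "step_start G s = step_end G (\<phi> x)" "step_end G s = x"
    then show thesis using that(2)[OF x] by simp
  qed
qed

text \<open>
  On a cycle take a vertex \<open>x\<close> that is the parent of no vertex of the cycle. Both edges of the
  cycle at \<open>x\<close> are then the parent edge of \<open>x\<close>, so they coincide and the cycle is a loop at \<open>x\<close>, which
  would make \<open>x\<close> its own parent.
\<close>

lemma parent_map_acyclic: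
  assumes G: "fin_digraph G" and \<phi>: "\<phi> \<in> parent_maps G r"
  shows "\<not> undirected_cycle (spanning_subgraph G (edges_of G r \<phi>)) p"
proof
  assume "undirected_cycle (spanning_subgraph G (edges_of G r \<phi>)) p"
  then have p: "p \<noteq> []" "fst ` set p \<subseteq> edges_of G r \<phi>" "distinct (map fst p)"
    and next_step: "\<And>i. i < length p \<Longrightarrow> step_end G (p ! i) = step_start G (p ! (Suc i mod length p))"
    unfolding undirected_cycle_def by auto
  have c: "\<phi> \<in> step_choices G r" and w: "wf (parent_rel G r \<phi>)" using \<phi> unfolding parent_maps_def by auto
  have "finite (parent_rel G r \<phi>)" using fin_digraph.finite_verts[OF G] unfolding parent_rel_def by auto
  then have "wf ((parent_rel G r \<phi>)\<inverse>)" using w by (simp add: finite_acyclic_wf_converse wf_acyclic)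
  moreover have "step_start G ` set p \<noteq> {}" using p by auto
  ultimately obtain x where x: "x \<in> step_start G ` set p"
    and no_pred: "\<And>y. (y, x) \<in> (parent_rel G r \<phi>)\<inverse> \<Longrightarrow> y \<notin> step_start G ` set p"
    by (rule wfE_min') blast
  have max: "step_end G (\<phi> y) \<noteq> x" if "y \<in> step_start G ` set p" "y \<in> verts G - {r}" for y
  proof
    assume "step_end G (\<phi> y) = x"
    then have "(x, y) \<in> parent_rel G r \<phi>" using that(2) unfolding parent_rel_def by blast
    then show False using no_pred[of y] that(1) by simp
  qed
  have ends: "step_end G s \<in> step_start G ` set p" if "s \<in> set p" for s
  proof -
    obtain i where "i < length p" "s = p ! i" using \<open>s \<in> set p\<close> by (metis in_set_conv_nth)
    then show ?thesis using next_step[of i] p(1) by simp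
  qed
  have edge: "fst s = fst (\<phi> x) \<and> x \<in> verts G - {r}" if s: "s \<in> set p" "step_start G s = x \<or> step_end G s = x" for s
  proof -
    have "fst s \<in> edges_of G r \<phi>" using p(2) s by auto
    with c show ?thesis
    proof (cases rule: edge_of_parent_mapE)
      case (1 y)
      then have "step_end G s \<noteq> x" using max[of y] s by auto
      then show ?thesis using 1 s by auto
    next
      case (2 y)
      then have "step_start G s \<noteq> x" using max[of y] ends s by auto
      then show ?thesis using 2 s by auto
    qed
  qed
  obtain i where i: "i < length p" "x = step_start G (p ! i)"
    using x by (metis imageE in_set_conv_nth)
  \<comment> \<open>the position of the step of the cycle that enters \<open>x\<close>\<close>
  define j where "j = (if i = 0 then length p - 1 else i - 1)"
  have j: "j < length p" "Suc j mod length p = i" using i p(1) unfolding j_def by auto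
  have "step_end G (p ! j) = x" using next_step[OF j(1)] j(2) i by simp
  then have "fst (p ! j) = fst (\<phi> x)" "x \<in> verts G - {r}" using edge[of "p ! j"] j by auto
  moreover have ei: "fst (p ! i) = fst (\<phi> x)" using edge[of "p ! i"] i by auto
  ultimately have "i = j" using p(3) i(1) j(1) by (simp add: distinct_conv_nth) metis
  then have "step_end G (p ! i) = step_start G (p ! i)" using next_step[OF i(1)] j by simp
  then have "step_end G (\<phi> x) = x" using step_ends_same_edge[OF ei, of G] i by auto
  then show False using max[of x] x \<open>x \<in> verts G - {r}\<close> by auto
qed

text \<open>
  Induction from the root upwards. If \<open>\<psi>\<close> does not choose the edge of \<open>\<phi> u\<close> at \<open>u\<close>, it chooses it at the
  parent \<open>y\<close> of \<open>u\<close>. By induction \<open>\<phi>\<close> does so too, and then \<open>u\<close> and \<open>y\<close> are parents of each other.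
\<close>

lemma parent_map_determined_by_edges:
  assumes \<phi>: "\<phi> \<in> parent_maps G r" and \<psi>: "\<psi> \<in> parent_maps G r"
    and eq: "edges_of G r \<phi> = edges_of G r \<psi>"
  shows "\<phi> = \<psi>"
proof -
  have c: "\<phi> \<in> step_choices G r" "\<psi> \<in> step_choices G r"
    and w: "wf (parent_rel G r \<phi>)" "wf (parent_rel G r \<psi>)" using \<phi> \<psi> unfolding parent_maps_def by auto
  have "\<phi> u = \<psi> u" if "u \<in> verts G - {r}" for u
    using w(1) that
  proof (induction u rule: wf_induct_rule)
    case (less u)
    have su: "step_start G (\<phi> u) = u" "step_start G (\<psi> u) = u"
      using step_choicesD(2) c less.prems by fastforce+
    have down: "(step_end G (\<phi> y), y) \<in> parent_rel G r \<phi>" "(step_end G (\<psi> y), y) \<in> parent_rel G r \<psi>"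
      if "y \<in> verts G - {r}" for y using that unfolding parent_rel_def by auto
    have "fst (\<phi> u) \<in> edges_of G r \<phi>" using less.prems unfolding edges_of_def by (rule imageI)
    then have "fst (\<phi> u) \<in> edges_of G r \<psi>" unfolding eq .
    with c(2) show ?case
    proof (cases rule: edge_of_parent_mapE)
      case (1 y)
      then have yu: "y = u" using su by simp
      have "step_end G (\<psi> u) \<noteq> u" using down(2)[OF less.prems] w(2) by (metis wf_not_refl)
      then have "snd (\<phi> u) = snd (\<psi> u)"
        using 1 su yu by (auto simp: step_start_def step_end_def split: if_splits)
      then show ?thesis using 1 yu by (simp add: prod_eq_iff)
    next
      case (2 y)
      have "\<phi> y = \<psi> y" using less.IH down(1)[OF less.prems] 2 by auto
      then have "(u, y) \<in> parent_rel G r \<phi>" using down(1)[of y] 2 su by simp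
      moreover have "(y, u) \<in> parent_rel G r \<phi>" using down(1)[OF less.prems] 2 by simp
      ultimately show ?thesis using w(1) by (meson wf_not_sym)
    qed
  qed
  then show ?thesis using c unfolding step_choices_def by (intro PiE_ext) auto
qed

text \<open>
  Let every vertex step to a vertex that is closer to \<open>r\<close>.
\<close>

lemma connected_has_parent_map:
  assumes conn: "\<forall>u\<in>verts G. (u, r) \<in> (step_rel G F)\<^sup>*" and F: "F \<subseteq> arcs G"
  shows "\<exists>\<phi>\<in>parent_maps G r. edges_of G r \<phi> \<subseteq> F"
proof -
  define d where "d u = (LEAST n. (u, r) \<in> step_rel G F ^^ n)" for u
  have "\<exists>s. s \<in> F \<times> UNIV \<and> step_start G s = u \<and> d (step_end G s) < d u"
    if u: "u \<in> verts G - {r}" for u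
  proof -
    obtain k where "(u, r) \<in> step_rel G F ^^ k" using conn u rtrancl_imp_relpow by blast
    then have k: "(u, r) \<in> step_rel G F ^^ d u" unfolding d_def by (rule LeastI)
    then obtain n where n: "d u = Suc n" using u by (cases "d u") auto
    then obtain x where "(u, x) \<in> step_rel G F" "(x, r) \<in> step_rel G F ^^ n"
      using k relpow_Suc_D2 by metis
    moreover have "d x \<le> n" unfolding d_def using calculation(2) by (rule Least_le)
    ultimately show ?thesis using n unfolding step_rel_def by fastforce
  qed
  then obtain f where f: "\<And>u. u \<in> verts G - {r} \<Longrightarrow> f u \<in> F \<times> UNIV \<and> step_start G (f u) = u \<and> d (step_end G (f u)) < d u"
    by metis
  define \<phi> where "\<phi> = restrict f (verts G - {r})"
  have "\<phi> \<in> step_choices G r" unfolding step_choices_def \<phi>_def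
  proof (rule restrict_PiE_iff[THEN iffD2], rule ballI)
    fix u assume "u \<in> verts G - {r}"
    then show "f u \<in> {s \<in> arcs G \<times> UNIV. step_start G s = u}" using f[of u] F by (auto simp: mem_Times_iff)
  qed
  moreover have desc: "d (step_end G (\<phi> u)) < d u" if "u \<in> verts G - {r}" for u
    using f[OF that] that unfolding \<phi>_def by simp
  have "parent_rel G r \<phi> \<subseteq> measure d"
    unfolding parent_rel_def by (rule image_subsetI, subst in_measure, rule desc)
  then have "wf (parent_rel G r \<phi>)" by (rule wf_subset[OF wf_measure])
  moreover have "edges_of G r \<phi> \<subseteq> F" using f unfolding edges_of_def \<phi>_def by (auto simp: mem_Times_iff)
  ultimately show ?thesis unfolding parent_maps_def by blast
qed

text \<open>
  For surjectivity, choose a parent map inside the given tree. Its edges already connect the graph,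
  so a further edge of the tree would close a cycle.
\<close>

lemma bij_betw_parent_maps_spanning_trees:
  assumes G: "fin_digraph G" and r: "r \<in> verts G"
  shows "bij_betw (\<lambda>\<phi>. spanning_subgraph G (edges_of G r \<phi>)) (parent_maps G r)
           {H. spanning H G \<and> undirected_tree H}"
proof (rule bij_betw_imageI)
  interpret fin_digraph G by (rule G)
  have wfG: "wf_digraph G" by unfold_locales
  show "inj_on (\<lambda>\<phi>. spanning_subgraph G (edges_of G r \<phi>)) (parent_maps G r)"
    by (intro inj_onI parent_map_determined_by_edges) (auto simp: spanning_subgraph_def)
  have conn: "connected (spanning_subgraph G F) \<longleftrightarrow> (\<forall>u\<in>verts G. \<forall>v\<in>verts G. (u, v) \<in> (step_rel G F)\<^sup>*)"
    if "F \<subseteq> arcs G" for F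
  proof -
    have "spanning (spanning_subgraph G F) G" using that spanning_iff[OF wfG] by blast
    then have "wf_digraph (spanning_subgraph G F)" unfolding spanning_def subgraph_def by blast
    from connected_iff_step_rel[OF this] show ?thesis using r by auto
  qed
  show "(\<lambda>\<phi>. spanning_subgraph G (edges_of G r \<phi>)) ` parent_maps G r = {H. spanning H G \<and> undirected_tree H}"
  proof (intro equalityI subsetI)
    fix H assume "H \<in> (\<lambda>\<phi>. spanning_subgraph G (edges_of G r \<phi>)) ` parent_maps G r"
    then obtain \<phi> where \<phi>: "\<phi> \<in> parent_maps G r" and H: "H = spanning_subgraph G (edges_of G r \<phi>)" by blast
    have sub: "edges_of G r \<phi> \<subseteq> arcs G" using \<phi> unfolding parent_maps_def by (auto dest: edges_of_subset)
    have "connected H" unfolding H conn[OF sub] using parent_map_connects[OF wfG \<phi>] by blast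
    moreover have "\<not> undirected_cycle H p" for p unfolding H by (rule parent_map_acyclic[OF G \<phi>])
    moreover have "spanning H G" using spanning_iff[OF wfG] sub H by blast
    ultimately show "H \<in> {H. spanning H G \<and> undirected_tree H}" unfolding undirected_tree_def by blast
  next
    fix H assume "H \<in> {H. spanning H G \<and> undirected_tree H}"
    then obtain F where F: "F \<subseteq> arcs G" and H: "H = spanning_subgraph G F"
      and tree: "connected H" "\<nexists>p. undirected_cycle H p"
      using spanning_iff[OF wfG] unfolding undirected_tree_def by blast
    have reach: "\<forall>u\<in>verts G. (u, r) \<in> (step_rel G F)\<^sup>*" using tree(1) conn[OF F] r unfolding H by blast
    then obtain \<phi> where \<phi>: "\<phi> \<in> parent_maps G r" and sub: "edges_of G r \<phi> \<subseteq> F"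
      using connected_has_parent_map[OF reach F] by blast
    have "e \<in> edges_of G r \<phi>" if e: "e \<in> F" for e
    proof (rule ccontr)
      assume "e \<notin> edges_of G r \<phi>"
      moreover have "(head G e, tail G e) \<in> (step_rel G (edges_of G r \<phi>))\<^sup>*"
        using parent_map_connects[OF wfG \<phi>] e F by auto
      ultimately show False
        using undirected_cycle_if_connected_without_edge[of e H "edges_of G r \<phi>"] sub e tree(2) unfolding H by simp
    qed
    then have "F = edges_of G r \<phi>" using sub by blast
    then show "H \<in> (\<lambda>\<phi>. spanning_subgraph G (edges_of G r \<phi>)) ` parent_maps G r" using \<phi> H by blast
  qed
qed

section \<open>The Laplacian as a sum over steps\<close>

lemma boundary_transpose_apply:
  assumes "fin_digraph G" "e \<in> arcs G"
  shows "boundary_transpose G x e = x (head G e) - x (tail G e)"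
proof -
  interpret fin_digraph G by fact
  have "boundary_transpose G x e =
      (\<Sum>v\<in>verts G. (if v = head G e then x v else 0) - (if v = tail G e then x v else 0))"
    using assms(2) unfolding boundary_transpose_def incidence_def
    by (auto intro!: sum.cong simp: left_diff_distrib)
  also have "\<dots> = x (head G e) - x (tail G e)"
    using assms(2) by (simp add: sum_subtractf)
  finally show ?thesis .
qed

text \<open>
  Every edge with exactly one end at \<open>v\<close> gives one step from \<open>v\<close>. A loop at \<open>v\<close> has incidence \<open>0\<close>, and its
  two steps contribute \<open>x v - x v\<close>.
\<close>

lemma laplacian_apply:
  assumes G: "fin_digraph G" and v: "v \<in> verts G"
  shows "laplacian G x v = (\<Sum>s | s \<in> arcs G \<times> UNIV \<and> step_start G s = v. x v - x (step_end G s))"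
proof -
  interpret fin_digraph G by fact
  have "laplacian G x v = (\<Sum>e\<in>arcs G. incidence G v e * (x (head G e) - x (tail G e)))"
    using v boundary_transpose_apply[OF G] unfolding laplacian_def boundary_def by simp
  also have "\<dots> = (\<Sum>e\<in>arcs G. \<Sum>d\<in>UNIV. if step_start G (e, d) = v then x v - x (step_end G (e, d)) else 0)"
    by (intro sum.cong refl) (auto simp: UNIV_bool incidence_def step_start_def step_end_def)
  also have "\<dots> = (\<Sum>s\<in>arcs G \<times> UNIV. if step_start G s = v then x v - x (step_end G s) else 0)"
    unfolding sum.cartesian_product by (intro sum.cong refl) auto
  also have "\<dots> = (\<Sum>s | s \<in> arcs G \<times> UNIV \<and> step_start G s = v. x v - x (step_end G s))"
    by (rule sum.inter_filter[symmetric]) simp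
  finally show ?thesis .
qed

text \<open>
  The boundary and its transpose are adjoint for the standard pairings. Self-adjointness of the
  Laplacian and the vanishing of the degree on its image both follow.
\<close>

lemma boundary_adjoint:
  assumes "fin_digraph G"
  shows "(\<Sum>v\<in>verts G. y v * boundary G c v) = (\<Sum>e\<in>arcs G. boundary_transpose G y e * c e)"
proof -
  have "(\<Sum>v\<in>verts G. y v * boundary G c v) = (\<Sum>v\<in>verts G. \<Sum>e\<in>arcs G. y v * (incidence G v e * c e))"
    unfolding boundary_def by (simp add: sum_distrib_left)
  also have "\<dots> = (\<Sum>e\<in>arcs G. \<Sum>v\<in>verts G. y v * (incidence G v e * c e))" by (rule sum.swap)
  also have "\<dots> = (\<Sum>e\<in>arcs G. boundary_transpose G y e * c e)"
    unfolding boundary_transpose_def by (simp add: sum_distrib_left sum_distrib_right mult_ac)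
  finally show ?thesis .
qed

lemma laplacian_self_adjoint:
  assumes "fin_digraph G"
  shows "(\<Sum>v\<in>verts G. y v * laplacian G x v) = (\<Sum>v\<in>verts G. laplacian G y v * x v)"
  using boundary_adjoint[OF assms, of y "boundary_transpose G x"]
    boundary_adjoint[OF assms, of x "boundary_transpose G y"]
  unfolding laplacian_def by (simp add: mult_ac)

lemma deg_laplacian:
  assumes "fin_digraph G"
  shows "deg (verts G) (laplacian G x) = 0"
  using boundary_adjoint[OF assms, of "\<lambda>_. 1" "boundary_transpose G x"] boundary_transpose_apply[OF assms]
  unfolding laplacian_def deg_def by simp

lemma laplacian_expand:
  assumes G: "fin_digraph G" and v: "v \<in> verts G"
  shows "laplacian G x v = (\<Sum>w\<in>verts G. x w * laplacian G (basis_vec (verts G) w) v)"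
proof -
  interpret fin_digraph G by fact
  have x: "x u = (\<Sum>w\<in>verts G. x w * basis_vec (verts G) w u)" if "u \<in> verts G" for u
  proof -
    have "(\<Sum>w\<in>verts G. x w * basis_vec (verts G) w u) = (\<Sum>w\<in>verts G. if w = u then x w else 0)"
      using that unfolding basis_vec_def by (intro sum.cong refl) auto
    then show ?thesis using that by simp
  qed
  have "(\<Sum>w\<in>verts G. x w * laplacian G (basis_vec (verts G) w) v) =
      (\<Sum>w\<in>verts G. \<Sum>s | s \<in> arcs G \<times> UNIV \<and> step_start G s = v.
         x w * basis_vec (verts G) w v - x w * basis_vec (verts G) w (step_end G s))"
    by (simp add: laplacian_apply[OF G v] sum_distrib_left right_diff_distrib)
  also have "\<dots> = (\<Sum>s | s \<in> arcs G \<times> UNIV \<and> step_start G s = v. \<Sum>w\<in>verts G.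
         x w * basis_vec (verts G) w v - x w * basis_vec (verts G) w (step_end G s))" by (rule sum.swap)
  also have "\<dots> = (\<Sum>s | s \<in> arcs G \<times> UNIV \<and> step_start G s = v. x v - x (step_end G s))"
  proof (intro sum.cong refl)
    fix s assume "s \<in> {s. s \<in> arcs G \<times> UNIV \<and> step_start G s = v}"
    then have "step_end G s \<in> verts G" using step_in_verts(2)[OF wf_digraph_axioms, of s] by auto
    then show "(\<Sum>w\<in>verts G. x w * basis_vec (verts G) w v - x w * basis_vec (verts G) w (step_end G s)) =
        x v - x (step_end G s)"
      unfolding sum_subtractf using x[OF v] x[of "step_end G s"] by simp
  qed
  finally show ?thesis using laplacian_apply[OF G v] by simp
qed

lemma laplacian_in_carrier: "laplacian G x \<in> verts G \<rightarrow>\<^sub>E UNIV"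
  unfolding laplacian_def boundary_def by auto

lemma laplacian_add:
  assumes "fin_digraph G"
  shows "laplacian G (\<lambda>v\<in>verts G. x v + y v) = (\<lambda>v\<in>verts G. laplacian G x v + laplacian G y v)"
proof (rule extensionalityI[of _ "verts G"])
  fix v assume v: "v \<in> verts G"
  show "laplacian G (\<lambda>v\<in>verts G. x v + y v) v = (\<lambda>v\<in>verts G. laplacian G x v + laplacian G y v) v"
    using v laplacian_expand[OF assms v, of "\<lambda>v\<in>verts G. x v + y v"] laplacian_expand[OF assms v, of x]
      laplacian_expand[OF assms v, of y]
    by (simp add: distrib_right sum.distrib)
qed (use laplacian_in_carrier[of G] in \<open>auto simp: PiE_def\<close>)

lemma laplacian_shift:
  assumes G: "fin_digraph G"
  shows "laplacian G (\<lambda>v\<in>verts G. x v - c) = laplacian G x"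
proof (rule extensionalityI[of _ "verts G"])
  interpret fin_digraph G by fact
  fix v assume v: "v \<in> verts G"
  show "laplacian G (\<lambda>v\<in>verts G. x v - c) v = laplacian G x v"
    unfolding laplacian_apply[OF G v]
  proof (intro sum.cong refl)
    fix s assume "s \<in> {s. s \<in> arcs G \<times> UNIV \<and> step_start G s = v}"
    then have "step_end G s \<in> verts G" using step_in_verts(2)[OF wf_digraph_axioms, of s] by auto
    then show "(\<lambda>v\<in>verts G. x v - c) v - (\<lambda>v\<in>verts G. x v - c) (step_end G s) = x v - x (step_end G s)"
      using v by simp
  qed
qed (use laplacian_in_carrier[of G] in \<open>auto simp: PiE_def\<close>)

section \<open>The matrix tree theorem\<close>

text \<open>
  The reduced Laplacian, indexed by a list of the vertices that are kept.
\<close>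

definition principal_laplacian_mat :: "('a, 'b) pre_digraph \<Rightarrow> 'a list \<Rightarrow> int mat" where
  "principal_laplacian_mat G us =
     mat (length us) (length us) (\<lambda>(a, b). laplacian G (basis_vec (verts G) (us ! b)) (us ! a))"

lemma reduced_laplacian_mat_eq:
  assumes "i < length vs"
  shows "reduced_laplacian_mat G vs i = principal_laplacian_mat G (take i vs @ drop (Suc i) vs)"
  using assms unfolding reduced_laplacian_mat_def laplacian_mat_def mat_delete_def principal_laplacian_mat_def
  by (intro eq_matI) (auto simp: nth_append)

text \<open>
  Distributivity of a product over sums, with the factors numbered by positions and the choices
  indexed by the entries of the list. This carries the row expansion of the determinant from row
  numbers to vertices.
\<close>

lemma prod_sum_nth:
  fixes f :: "nat \<Rightarrow> 'b \<Rightarrow> 'c :: comm_semiring_1"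
  assumes d: "distinct us" and fin: "\<And>u. u \<in> set us \<Longrightarrow> finite (B u)"
  shows "(\<Prod>i = 0..<length us. \<Sum>s\<in>B (us ! i). f i s) =
         (\<Sum>\<phi>\<in>Pi\<^sub>E (set us) B. \<Prod>i = 0..<length us. f i (\<phi> (us ! i)))"
proof -
  define idx where "idx = inv_into {0..<length us} ((!) us)"
  have bij: "bij_betw ((!) us) {0..<length us} (set us)"
    using bij_betw_nth[OF d, of "{0..<length us}" "set us"] by (auto simp: lessThan_atLeast0)
  then have idx: "idx (us ! i) = i" if "i < length us" for i
    using that unfolding idx_def by (simp add: bij_betw_inv_into_left)
  have "(\<Prod>i = 0..<length us. \<Sum>s\<in>B (us ! i). f i s) = (\<Prod>u\<in>set us. \<Sum>s\<in>B u. f (idx u) s)"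
    unfolding prod.reindex_bij_betw[OF bij, symmetric] using idx by (intro prod.cong refl) simp
  also have "\<dots> = (\<Sum>\<phi>\<in>Pi\<^sub>E (set us) B. \<Prod>u\<in>set us. f (idx u) (\<phi> u))"
    by (rule prod_sum_PiE) (use fin in auto)
  also have "\<dots> = (\<Sum>\<phi>\<in>Pi\<^sub>E (set us) B. \<Prod>i = 0..<length us. f i (\<phi> (us ! i)))"
    unfolding prod.reindex_bij_betw[OF bij, symmetric] using idx by (intro sum.cong prod.cong refl) simp
  finally show ?thesis .
qed

lemma sum_nth_distinct:
  fixes g :: "'a \<Rightarrow> int"
  assumes "distinct us"
  shows "(\<Sum>b = 0..<length us. g (us ! b)) = (\<Sum>w\<in>set us. g w)"
  using sum.reindex_bij_betw[OF bij_betw_nth[OF assms refl refl], of g] by (simp add: lessThan_atLeast0)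

text \<open>
  The matrix is unitriangular for the order of the indices by the well-founded relation. In the
  permutation expansion only the identity survives: a permutation that moves indices only down along
  \<open>R\<close> is the identity, by well-founded induction and injectivity.
\<close>

lemma det_wf_unitriangular:
  fixes A :: "int mat"
  assumes A: "A \<in> carrier_mat n n" and w: "wf R"
    and diag: "\<And>i. i < n \<Longrightarrow> A $$ (i, i) = 1"
    and off: "\<And>i j. i < n \<Longrightarrow> j < n \<Longrightarrow> i \<noteq> j \<Longrightarrow> A $$ (i, j) \<noteq> 0 \<Longrightarrow> (f j, f i) \<in> R"
  shows "det A = 1"
proof -
  have zero: "(\<Prod>i = 0..<n. A $$ (i, p i)) = 0" if p: "p permutes {0..<n}" "p \<noteq> id" for p
  proof (rule ccontr)
    assume "(\<Prod>i = 0..<n. A $$ (i, p i)) \<noteq> 0"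
    then have nz: "A $$ (i, p i) \<noteq> 0" if "i < n" for i using that by auto
    have pn: "p i < n" if "i < n" for i using permutes_in_image[OF p(1)] that by auto
    have "i < n \<longrightarrow> p i = i" for i
    proof (induction i rule: wf_induct_rule[OF wf_inv_image[OF w, of f]])
      case (1 i)
      show ?case
      proof (rule impI, rule ccontr)
        assume i: "i < n" and ne: "p i \<noteq> i"
        have "(f (p i), f i) \<in> R" using off[OF i pn[OF i]] ne nz[OF i] by auto
        then have "p (p i) = p i" using 1 pn[OF i] by auto
        then show False using ne permutes_inj[OF p(1)] by (auto dest: injD)
      qed
    qed
    then have "p = id" using permutes_not_in[OF p(1)] by (intro ext) (metis atLeastLessThan_iff id_apply le0)
    then show False using p(2) by contradiction
  qed
  have "det A = (\<Sum>p | p permutes {0..<n}. signof p * (\<Prod>i = 0..<n. A $$ (i, p i)))" by (rule det_def'[OF A])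
  also have "\<dots> = (\<Sum>p\<in>{id}. signof p * (\<Prod>i = 0..<n. A $$ (i, p i)))"
    by (rule sum.mono_neutral_right) (auto simp: finite_permutations permutes_id zero)
  also have "\<dots> = 1" using diag by simp
  finally show ?thesis .
qed

text \<open>
  \<open>I - P\<close>, where \<open>P\<close> is the adjacency matrix of the functional graph of \<open>\<phi>\<close> with the root removed.
\<close>

definition choice_mat :: "('a, 'b) pre_digraph \<Rightarrow> 'a list \<Rightarrow> ('a \<Rightarrow> 'b \<times> bool) \<Rightarrow> int mat" where
  "choice_mat G us \<phi> = mat (length us) (length us)
     (\<lambda>(a, b). of_bool (us ! a = us ! b) - of_bool (step_end G (\<phi> (us ! a)) = us ! b))"

lemma not_wfE:
  assumes "\<not> wf R"
  obtains C where "C \<noteq> {}" "\<And>x. x \<in> C \<Longrightarrow> \<exists>y\<in>C. (y, x) \<in> R"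
proof -
  obtain C x where "x \<in> C" "\<not> (\<exists>z\<in>C. \<forall>y. (y, z) \<in> R \<longrightarrow> y \<notin> C)"
    using assms unfolding wf_eq_minimal by meson
  then show thesis using that[of C] by blast
qed

lemma det_choice_mat:
  assumes G: "fin_digraph G" and us: "distinct us" "set us = verts G - {r}"
    and \<phi>: "\<phi> \<in> step_choices G r"
  shows "det (choice_mat G us \<phi>) = of_bool (wf (parent_rel G r \<phi>))"
proof (cases "wf (parent_rel G r \<phi>)")
  case True
  have rel: "(step_end G (\<phi> (us ! i)), us ! i) \<in> parent_rel G r \<phi>" if "i < length us" for i
    using nth_mem[OF that] unfolding us(2) parent_rel_def by blast
  have "det (choice_mat G us \<phi>) = 1"
  proof (rule det_wf_unitriangular[OF _ True])
    show "choice_mat G us \<phi> \<in> carrier_mat (length us) (length us)" by (simp add: choice_mat_def)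
    show "choice_mat G us \<phi> $$ (i, i) = 1" if i: "i < length us" for i
      using i rel[OF i] True unfolding choice_mat_def by (auto dest: wf_not_refl)
    show "(us ! j, us ! i) \<in> parent_rel G r \<phi>"
      if "i < length us" "j < length us" "i \<noteq> j" "choice_mat G us \<phi> $$ (i, j) \<noteq> 0" for i j
      using that rel[OF that(1)] us(1) unfolding choice_mat_def
      by (auto simp: nth_eq_iff_index_eq of_bool_def split: if_splits)
  qed
  then show ?thesis using True by simp
next
  case False
  obtain C where C: "C \<noteq> {}" "\<And>x. x \<in> C \<Longrightarrow> \<exists>y\<in>C. (y, x) \<in> parent_rel G r \<phi>"
    using not_wfE[OF False] by metis
  \<comment> \<open>the vertices from which the root is never reached, as the largest set that avoids the root
    and is closed under \<open>\<phi>\<close>; being the largest, it is also closed backwards, so its indicator vector is fixed by \<open>P\<close>\<close>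
  define K where "K = \<Union>{C. C \<subseteq> verts G - {r} \<and> (\<forall>x\<in>C. step_end G (\<phi> x) \<in> C)}"
  have K_sub: "K \<subseteq> set us" and K_closed: "\<And>x. x \<in> K \<Longrightarrow> step_end G (\<phi> x) \<in> K"
    unfolding K_def us(2) by blast+
  have K_backward: "x \<in> K" if x: "x \<in> verts G - {r}" and e: "step_end G (\<phi> x) \<in> K" for x
  proof -
    have "insert x K \<subseteq> verts G - {r}" using K_sub us(2) x by blast
    moreover have "\<forall>y\<in>insert x K. step_end G (\<phi> y) \<in> insert x K" using e K_closed by blast
    ultimately show ?thesis unfolding K_def by blast
  qed
  have "C \<subseteq> verts G - {r} \<and> (\<forall>x\<in>C. step_end G (\<phi> x) \<in> C)"
    using C(2) unfolding parent_rel_def by blast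
  then have "C \<subseteq> K" unfolding K_def by blast
  with C(1) obtain x where "x \<in> K" by blast
  then obtain k where k: "k < length us" "us ! k \<in> K" using K_sub by (metis in_set_conv_nth subsetD)
  define v :: "int vec" where "v = vec (length us) (\<lambda>b. of_bool (us ! b \<in> K))"
  have v: "v \<in> carrier_vec (length us)" by (simp add: v_def)
  have "v $ k = 1" using k by (simp add: v_def)
  then have v0: "v \<noteq> 0\<^sub>v (length us)" using k by auto
  have M: "choice_mat G us \<phi> \<in> carrier_mat (length us) (length us)" by (simp add: choice_mat_def)
  have "choice_mat G us \<phi> *\<^sub>v v = 0\<^sub>v (length us)"
  proof (rule eq_vecI)
    fix a assume "a < dim_vec (0\<^sub>v (length us) :: int vec)"
    then have a: "a < length us" by simp
    define u where "u = us ! a"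
    have u: "u \<in> verts G - {r}" using nth_mem[OF a] us(2) unfolding u_def by simp
    have delta: "(\<Sum>w\<in>set us. if w = z then of_bool (w \<in> K) else 0) = (of_bool (z \<in> K) :: int)" for z
      using K_sub by (cases "z \<in> set us") auto
    have "(choice_mat G us \<phi> *\<^sub>v v) $ a = (\<Sum>b = 0..<length us.
        (of_bool (u = us ! b) - of_bool (step_end G (\<phi> u) = us ! b)) * of_bool (us ! b \<in> K))"
      using a by (simp add: choice_mat_def v_def scalar_prod_def u_def)
    also have "\<dots> = (\<Sum>w\<in>set us. (of_bool (u = w) - of_bool (step_end G (\<phi> u) = w)) * of_bool (w \<in> K))"
      by (rule sum_nth_distinct[OF us(1)])
    also have "\<dots> = (\<Sum>w\<in>set us. if w = u then of_bool (w \<in> K) else 0)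
        - (\<Sum>w\<in>set us. if w = step_end G (\<phi> u) then of_bool (w \<in> K) else 0)"
      unfolding sum_subtractf[symmetric] by (intro sum.cong refl) auto
    also have "\<dots> = of_bool (u \<in> K) - of_bool (step_end G (\<phi> u) \<in> K)"
      unfolding delta ..
    also have "\<dots> = 0" using K_closed K_backward[OF u] by auto
    finally show "(choice_mat G us \<phi> *\<^sub>v v) $ a = 0\<^sub>v (length us) $ a" using a by simp
  qed (simp add: choice_mat_def)
  then have "det (choice_mat G us \<phi>) = 0" using det_0_iff_vec_prod_zero[OF M] v v0 by blast
  then show ?thesis using False by simp
qed

text \<open>
  In the permutation expansion every factor is a sum over the steps from the vertex of its row.
  Multiplying out and exchanging the two sums leaves, for each choice of steps, the determinant of its
  choice matrix, which is \<open>1\<close> for a parent map and \<open>0\<close> otherwise.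
\<close>

theorem det_principal_laplacian_mat:
  assumes G: "fin_digraph G" and r: "r \<in> verts G" and us: "distinct us" "set us = verts G - {r}"
  shows "det (principal_laplacian_mat G us) = int (card (parent_maps G r))"
proof -
  interpret fin_digraph G by fact
  let ?n = "length us"
  let ?B = "\<lambda>u. {s \<in> arcs G \<times> UNIV. step_start G s = u}"
  let ?c = "\<lambda>a s b. of_bool (us ! a = us ! b) - of_bool (step_end G s = us ! b) :: int"
  have finB: "finite (?B u)" for u by (rule finite_subset[of _ "arcs G \<times> UNIV"]) auto
  have choices: "step_choices G r = Pi\<^sub>E (set us) ?B" unfolding step_choices_def us(2) ..
  have entry: "principal_laplacian_mat G us $$ (a, b) = (\<Sum>s\<in>?B (us ! a). ?c a s b)"
    if "a < ?n" "b < ?n" for a b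
  proof -
    have a: "us ! a \<in> verts G" using nth_mem[OF that(1)] us(2) by auto
    have "principal_laplacian_mat G us $$ (a, b) = laplacian G (basis_vec (verts G) (us ! b)) (us ! a)"
      using that unfolding principal_laplacian_mat_def by simp
    also have "\<dots> = (\<Sum>s\<in>?B (us ! a). ?c a s b)"
      unfolding laplacian_apply[OF G a]
    proof (intro sum.cong refl)
      fix s assume "s \<in> ?B (us ! a)"
      then have "step_end G s \<in> verts G" using step_in_verts(2)[OF wf_digraph_axioms, of s] by auto
      then show "basis_vec (verts G) (us ! b) (us ! a) - basis_vec (verts G) (us ! b) (step_end G s) = ?c a s b"
        using a unfolding basis_vec_def by simp
    qed
    finally show ?thesis .
  qed
  have "det (principal_laplacian_mat G us) =
      (\<Sum>p | p permutes {0..<?n}. signof p * (\<Prod>a = 0..<?n. principal_laplacian_mat G us $$ (a, p a)))"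
    by (rule det_def') (simp add: principal_laplacian_mat_def)
  also have "\<dots> = (\<Sum>p | p permutes {0..<?n}. signof p * (\<Prod>a = 0..<?n. \<Sum>s\<in>?B (us ! a). ?c a s (p a)))"
  proof (rule sum.cong[OF refl])
    fix p assume "p \<in> {p. p permutes {0..<?n}}"
    then have "p a < ?n" if "a < ?n" for a using permutes_in_image[of p "{0..<?n}" a] that by simp
    then have "(\<Prod>a = 0..<?n. principal_laplacian_mat G us $$ (a, p a)) = (\<Prod>a = 0..<?n. \<Sum>s\<in>?B (us ! a). ?c a s (p a))"
      using entry by (intro prod.cong[OF refl]) simp
    then show "signof p * (\<Prod>a = 0..<?n. principal_laplacian_mat G us $$ (a, p a)) =
        signof p * (\<Prod>a = 0..<?n. \<Sum>s\<in>?B (us ! a). ?c a s (p a))" by (rule arg_cong)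
  qed
  also have "\<dots> = (\<Sum>p | p permutes {0..<?n}. \<Sum>\<phi>\<in>step_choices G r.
      signof p * (\<Prod>a = 0..<?n. ?c a (\<phi> (us ! a)) (p a)))"
    unfolding choices
    by (subst prod_sum_nth[OF us(1) finB]) (simp only: sum_distrib_left)
  also have "\<dots> = (\<Sum>\<phi>\<in>step_choices G r. \<Sum>p | p permutes {0..<?n}.
      signof p * (\<Prod>a = 0..<?n. ?c a (\<phi> (us ! a)) (p a)))" by (rule sum.swap)
  also have "\<dots> = (\<Sum>\<phi>\<in>step_choices G r. det (choice_mat G us \<phi>))"
  proof (intro sum.cong refl)
    fix \<phi>
    have "det (choice_mat G us \<phi>) =
        (\<Sum>p | p permutes {0..<?n}. signof p * (\<Prod>a = 0..<?n. choice_mat G us \<phi> $$ (a, p a)))"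
      by (rule det_def') (simp add: choice_mat_def)
    also have "\<dots> = (\<Sum>p | p permutes {0..<?n}. signof p * (\<Prod>a = 0..<?n. ?c a (\<phi> (us ! a)) (p a)))"
    proof (rule sum.cong[OF refl])
      fix p assume "p \<in> {p. p permutes {0..<?n}}"
      then have "p a < ?n" if "a < ?n" for a using permutes_in_image[of p "{0..<?n}" a] that by simp
      then have "(\<Prod>a = 0..<?n. choice_mat G us \<phi> $$ (a, p a)) = (\<Prod>a = 0..<?n. ?c a (\<phi> (us ! a)) (p a))"
        unfolding choice_mat_def by (intro prod.cong[OF refl]) simp
      then show "signof p * (\<Prod>a = 0..<?n. choice_mat G us \<phi> $$ (a, p a)) =
          signof p * (\<Prod>a = 0..<?n. ?c a (\<phi> (us ! a)) (p a))" by (rule arg_cong)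
    qed
    finally show "(\<Sum>p | p permutes {0..<?n}. signof p * (\<Prod>a = 0..<?n. ?c a (\<phi> (us ! a)) (p a))) =
        det (choice_mat G us \<phi>)" ..
  qed
  also have "\<dots> = (\<Sum>\<phi>\<in>step_choices G r. of_bool (wf (parent_rel G r \<phi>)))"
    by (intro sum.cong refl det_choice_mat[OF G us])
  also have "\<dots> = int (card (parent_maps G r))"
    using finite_step_choices[OF G] unfolding parent_maps_def by (simp add: of_bool_def sum.inter_filter[symmetric])
  finally show ?thesis .
qed

section \<open>Torsion of the cokernel of the Laplacian\<close>

lemma comm_group_int_lattice: "comm_group (int_lattice S)"
proof -
  have "group (int_lattice S)" unfolding int_lattice_def by simp
  then show ?thesis
    by (rule group.group_comm_groupI) (auto simp: int_lattice_def add.commute)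
qed

lemma carrier_int_lattice [simp]: "carrier (int_lattice S) = S \<rightarrow>\<^sub>E UNIV"
  unfolding int_lattice_def by simp

lemma mult_int_lattice [simp]: "x \<otimes>\<^bsub>int_lattice S\<^esub> y = (\<lambda>s\<in>S. x s + y s)"
  unfolding int_lattice_def by simp

lemma inv_int_lattice: "x \<in> S \<rightarrow>\<^sub>E UNIV \<Longrightarrow> inv\<^bsub>int_lattice S\<^esub> x = (\<lambda>s\<in>S. - x s)"
  unfolding int_lattice_def by simp

lemma nat_pow_int_lattice: "x [^]\<^bsub>int_lattice S\<^esub> (n :: nat) = (\<lambda>s\<in>S. int n * x s)"
proof (induction n)
  case 0
  then show ?case by (simp add: int_lattice_def)
next
  case (Suc n)
  interpret comm_group "int_lattice S" by (rule comm_group_int_lattice)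
  show ?case unfolding nat_pow_Suc Suc by (rule ext) (simp add: algebra_simps)
qed

lemma (in normal) rcos_eq_iff:
  assumes "x \<in> carrier G" "y \<in> carrier G"
  shows "H #> x = H #> y \<longleftrightarrow> x \<otimes> inv y \<in> H"
  using rcos_module[OF is_group assms(2,1)] repr_independence[OF _ assms(2) is_subgroup]
    rcos_self[OF assms(1) is_subgroup] by metis

lemma (in normal) carrier_tors_Mod:
  "carrier (tors (G Mod H)) = (\<lambda>x. H #> x) ` {x \<in> carrier G. \<exists>n::nat. n > 0 \<and> x [^] n \<in> H}"
proof -
  interpret q: group_hom G "G Mod H" "\<lambda>x. H #> x"
    by (rule group_hom.intro[OF is_group factorgroup_is_group group_hom_axioms.intro[OF r_coset_hom_Mod]])
  have "(H #> x) [^]\<^bsub>G Mod H\<^esub> n = \<one>\<^bsub>G Mod H\<^esub> \<longleftrightarrow> x [^] n \<in> H" if x: "x \<in> carrier G" for x and n :: nat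
  proof -
    have "(H #> x) [^]\<^bsub>G Mod H\<^esub> n = H #> (x [^] n)" using q.hom_nat_pow[OF x] by simp
    then show ?thesis using rcos_const coset_join1 coset_join2 x is_subgroup
      by (metis nat_pow_closed one_FactGroup subset)
  qed
  then show ?thesis unfolding tors_def by (auto simp: carrier_FactGroup)
qed

lemma Prin_normal:
  assumes "fin_digraph G"
  shows "Prin G \<lhd> int_lattice (verts G)"
proof -
  let ?Z = "int_lattice (verts G)"
  interpret Z: comm_group ?Z by (rule comm_group_int_lattice)
  have "laplacian G \<in> hom ?Z ?Z"
    by (rule homI) (simp_all add: laplacian_in_carrier laplacian_add[OF assms])
  then interpret L: group_hom ?Z ?Z "laplacian G" by unfold_locales
  show ?thesis unfolding Prin_def using L.img_is_subgroup Z.subgroup_imp_normal by blast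
qed

definition coords :: "'a list \<Rightarrow> ('a \<Rightarrow> int) \<Rightarrow> int vec" where
  "coords us x = vec (length us) (\<lambda>a. x (us ! a))"

text \<open>
  A right inverse of \<open>coords us\<close> when the entries of \<open>us\<close> are distinct elements of \<open>V\<close>, with the value \<open>c\<close> at the vertices outside the list.
\<close>

definition extend :: "'a set \<Rightarrow> 'a list \<Rightarrow> int \<Rightarrow> int vec \<Rightarrow> 'a \<Rightarrow> int" where
  "extend V us c y = (\<lambda>v\<in>V. if v \<in> set us then y $ (THE a. a < length us \<and> us ! a = v) else c)"

lemma coords_carrier [simp]: "coords us x \<in> carrier_vec (length us)"
  by (simp add: coords_def)

lemma extend_nth:
  assumes "distinct us" "set us \<subseteq> V" "a < length us"
  shows "extend V us c y (us ! a) = y $ a"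
proof -
  have "(THE b. b < length us \<and> us ! b = us ! a) = a"
    using assms by (intro the_equality) (auto simp: nth_eq_iff_index_eq)
  moreover have "us ! a \<in> V" using assms(2) nth_mem[OF assms(3)] by blast
  ultimately show ?thesis using nth_mem[OF assms(3)] unfolding extend_def by simp
qed

lemma coords_extend:
  assumes "distinct us" "set us \<subseteq> V" "y \<in> carrier_vec (length us)"
  shows "coords us (extend V us c y) = y"
  using assms extend_nth[OF assms(1,2)] by (intro eq_vecI) (auto simp: coords_def)

text \<open>
  Deleting the row of \<open>r\<close> is forgetting the coordinate at \<open>r\<close> of the result; deleting the column of \<open>r\<close>
  loses nothing when \<open>x\<close> vanishes there.
\<close>

lemma coords_laplacian:
  assumes G: "fin_digraph G" and r: "r \<in> verts G" and us: "distinct us" "set us = verts G - {r}"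
    and x: "x r = 0"
  shows "coords us (laplacian G x) = principal_laplacian_mat G us *\<^sub>v coords us x"
proof (rule eq_vecI)
  fix a assume "a < dim_vec (principal_laplacian_mat G us *\<^sub>v coords us x)"
  then have a: "a < length us" by (simp add: principal_laplacian_mat_def)
  interpret fin_digraph G by fact
  have v: "us ! a \<in> verts G" using nth_mem[OF a] us(2) by auto
  have "coords us (laplacian G x) $ a = (\<Sum>w\<in>verts G. x w * laplacian G (basis_vec (verts G) w) (us ! a))"
    using a laplacian_expand[OF G v, of x] by (simp add: coords_def)
  also have "\<dots> = (\<Sum>w\<in>set us. x w * laplacian G (basis_vec (verts G) w) (us ! a))"
    using x r by (subst sum.remove[of _ r]) (auto simp: us(2))
  also have "\<dots> = (\<Sum>b = 0..<length us. x (us ! b) * laplacian G (basis_vec (verts G) (us ! b)) (us ! a))"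
    by (rule sum_nth_distinct[OF us(1), symmetric])
  also have "\<dots> = (principal_laplacian_mat G us *\<^sub>v coords us x) $ a"
    using a by (simp add: principal_laplacian_mat_def coords_def scalar_prod_def mult.commute)
  finally show "coords us (laplacian G x) $ a = (principal_laplacian_mat G us *\<^sub>v coords us x) $ a" .
qed (simp add: principal_laplacian_mat_def coords_def)

lemma deg_zero_eqI:
  assumes V: "finite V" "r \<in> V" "set us = V - {r}"
    and x: "x \<in> V \<rightarrow>\<^sub>E UNIV" "deg V x = 0" and y: "y \<in> V \<rightarrow>\<^sub>E UNIV" "deg V y = 0"
    and eq: "coords us x = coords us y"
  shows "x = y"
proof (rule PiE_ext[OF x(1) y(1)])
  have us: "x v = y v" if v: "v \<in> V - {r}" for v
  proof -
    have "v \<in> set us" using v V(3) by simp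
    then obtain a where a: "a < length us" "us ! a = v" unfolding in_set_conv_nth by blast
    then show ?thesis using arg_cong[OF eq, of "\<lambda>z. z $ a"] by (simp add: coords_def)
  qed
  then have "(\<Sum>v\<in>V - {r}. x v) = (\<Sum>v\<in>V - {r}. y v)" by (intro sum.cong) auto
  then have "x r = y r" using x(2) y(2) V(1,2) unfolding deg_def by (simp add: sum.remove[of V r])
  then show "x v = y v" if "v \<in> V" for v using us that by (cases "v = r") auto
qed

text \<open>
  By subtracting a constant, a principal divisor \<open>laplacian G z\<close> can be written with \<open>z r = 0\<close>. Conversely
  the coordinates away from \<open>r\<close> determine a vector of degree \<open>0\<close>, so it is enough to solve the reduced
  system.
\<close>

lemma Prin_iff_coords:
  assumes G: "fin_digraph G" and r: "r \<in> verts G" and us: "distinct us" "set us = verts G - {r}"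
    and x: "x \<in> verts G \<rightarrow>\<^sub>E UNIV" "deg (verts G) x = 0"
  shows "x \<in> Prin G \<longleftrightarrow> (\<exists>y\<in>carrier_vec (length us). coords us x = principal_laplacian_mat G us *\<^sub>v y)"
proof
  assume "x \<in> Prin G"
  then obtain z where "x = laplacian G z" unfolding Prin_def by blast
  then have "x = laplacian G (\<lambda>v\<in>verts G. z v - z r)" using laplacian_shift[OF G] by simp
  then have "coords us x = principal_laplacian_mat G us *\<^sub>v coords us (\<lambda>v\<in>verts G. z v - z r)"
    using coords_laplacian[OF G r us, of "\<lambda>v\<in>verts G. z v - z r"] r by simp
  then show "\<exists>y\<in>carrier_vec (length us). coords us x = principal_laplacian_mat G us *\<^sub>v y"
    using coords_carrier by blast
next
  assume "\<exists>y\<in>carrier_vec (length us). coords us x = principal_laplacian_mat G us *\<^sub>v y"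
  then obtain y where y: "y \<in> carrier_vec (length us)" "coords us x = principal_laplacian_mat G us *\<^sub>v y" by blast
  let ?z = "extend (verts G) us 0 y"
  have sub: "set us \<subseteq> verts G" using us(2) by auto
  have "?z r = 0" using r us(2) by (simp add: extend_def)
  then have "coords us (laplacian G ?z) = coords us x"
    using coords_laplacian[OF G r us] coords_extend[OF us(1) sub y(1)] y(2) by simp
  then have "laplacian G ?z = x"
    by (intro deg_zero_eqI[OF fin_digraph.finite_verts[OF G] r us(2) laplacian_in_carrier deg_laplacian[OF G] x])
  moreover have "?z \<in> carrier (int_lattice (verts G))" by (auto simp: extend_def)
  ultimately show "x \<in> Prin G" unfolding Prin_def by blast
qed

lemma scalar_mat_mult_vec:
  fixes d :: int
  assumes w: "w \<in> carrier_vec n"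
  shows "(d \<cdot>\<^sub>m 1\<^sub>m n) *\<^sub>v w = d \<cdot>\<^sub>v w"
proof (rule eq_vecI)
  fix i assume "i < dim_vec (d \<cdot>\<^sub>v w)"
  then have i: "i < n" using w by simp
  have "((d \<cdot>\<^sub>m 1\<^sub>m n) *\<^sub>v w) $ i = (\<Sum>j = 0..<n. d * (if j = i then 1 else 0) * w $ j)"
    using i w by (simp add: scalar_prod_def)
  also have "\<dots> = (\<Sum>j = 0..<n. if j = i then d * w $ j else 0)" by (intro sum.cong) auto
  finally show "((d \<cdot>\<^sub>m 1\<^sub>m n) *\<^sub>v w) $ i = (d \<cdot>\<^sub>v w) $ i" using i w by simp
qed (use w in simp)

text \<open>
  The degree vanishes on the image of the Laplacian and takes values in a torsion-free group, so it
  vanishes on torsion. Conversely the adjugate of the reduced Laplacian solves the reduced system for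
  \<open>det\<close> times any vector.
\<close>

lemma multiple_in_Prin_iff_deg:
  assumes G: "fin_digraph G" and r: "r \<in> verts G" and us: "distinct us" "set us = verts G - {r}"
    and det: "det (principal_laplacian_mat G us) > 0"
    and x: "x \<in> verts G \<rightarrow>\<^sub>E UNIV"
  shows "(\<exists>n::nat. n > 0 \<and> (\<lambda>v\<in>verts G. int n * x v) \<in> Prin G) \<longleftrightarrow> deg (verts G) x = 0"
proof
  assume "\<exists>n::nat. n > 0 \<and> (\<lambda>v\<in>verts G. int n * x v) \<in> Prin G"
  then obtain n z where n: "n > 0" "(\<lambda>v\<in>verts G. int n * x v) = laplacian G z" unfolding Prin_def by auto
  have "int n * deg (verts G) x = deg (verts G) (\<lambda>v\<in>verts G. int n * x v)"
    unfolding deg_def by (simp add: sum_distrib_left)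
  also have "\<dots> = 0" unfolding n(2) by (rule deg_laplacian[OF G])
  finally show "deg (verts G) x = 0" using n(1) by simp
next
  assume d: "deg (verts G) x = 0"
  let ?M = "principal_laplacian_mat G us"
  define n where "n = nat (det ?M)"
  have n: "n > 0" "int n = det ?M" using det unfolding n_def by auto
  have M: "?M \<in> carrier_mat (length us) (length us)" by (simp add: principal_laplacian_mat_def)
  let ?y = "\<lambda>v\<in>verts G. int n * x v"
  have "coords us ?y = det ?M \<cdot>\<^sub>v coords us x"
    using us(2) nth_mem[of _ us] n(2) by (intro eq_vecI) (auto simp: coords_def)
  also have "\<dots> = (det ?M \<cdot>\<^sub>m 1\<^sub>m (length us)) *\<^sub>v coords us x"
    by (rule scalar_mat_mult_vec[OF coords_carrier, symmetric])
  also have "\<dots> = ?M *\<^sub>v (adj_mat ?M *\<^sub>v coords us x)"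
    unfolding adj_mat(2)[OF M, symmetric] by (rule assoc_mult_mat_vec[OF M adj_mat(1)[OF M] coords_carrier])
  finally have "coords us ?y = ?M *\<^sub>v (adj_mat ?M *\<^sub>v coords us x)" .
  moreover have "adj_mat ?M *\<^sub>v coords us x \<in> carrier_vec (length us)"
    by (rule mult_mat_vec_carrier[OF adj_mat(1)[OF M] coords_carrier])
  moreover have "deg (verts G) ?y = 0" using d unfolding deg_def by (simp add: sum_distrib_left[symmetric])
  ultimately have "?y \<in> Prin G" using Prin_iff_coords[OF G r us, of ?y] by auto
  then show "\<exists>n::nat. n > 0 \<and> (\<lambda>v\<in>verts G. int n * x v) \<in> Prin G" using n(1) by blast
qed

text \<open>
  A transversal of the column lattice of the reduced Laplacian, completed to vectors of degree \<open>0\<close>,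
  represents every torsion coset exactly once.
\<close>

theorem order_tors_coker_laplacian:
  assumes G: "fin_digraph G" and r: "r \<in> verts G" and us: "distinct us" "set us = verts G - {r}"
    and det: "det (principal_laplacian_mat G us) > 0"
  shows "int (Coset.order (tors (int_lattice (verts G) Mod Prin G))) = det (principal_laplacian_mat G us)"
proof -
  let ?V = "verts G" and ?M = "principal_laplacian_mat G us" and ?Z = "int_lattice (verts G)"
  interpret fin_digraph G by fact
  interpret Z: comm_group ?Z by (rule comm_group_int_lattice)
  interpret N: normal "Prin G" ?Z by (rule Prin_normal[OF G])
  have M: "?M \<in> carrier_mat (length us) (length us)" by (simp add: principal_laplacian_mat_def)
  have sub: "set us \<subseteq> ?V" using us(2) by auto
  obtain T where T: "finite T" "card T = nat \<bar>det ?M\<bar>" "transversal ?M T"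
    using exists_transversal_card_det[OF M] det by auto
  have Tc: "T \<subseteq> carrier_vec (length us)" by (rule transversal_carrier[OF T(3) M])
  \<comment> \<open>the coordinate at \<open>r\<close> is forced by degree \<open>0\<close>\<close>
  define lift where "lift t = extend ?V us (- (\<Sum>a = 0..<length us. t $ a)) t" for t
  have lift_c: "lift t \<in> ?V \<rightarrow>\<^sub>E UNIV" for t unfolding lift_def extend_def by auto
  have lift_coords: "coords us (lift t) = t" if "t \<in> carrier_vec (length us)" for t
    unfolding lift_def by (rule coords_extend[OF us(1) sub that])
  have lift_deg: "deg ?V (lift t) = 0" for t
  proof -
    have "deg ?V (lift t) = lift t r + (\<Sum>w\<in>set us. lift t w)"
      unfolding deg_def us(2) using r by (simp add: sum.remove[of ?V r])
    also have "(\<Sum>w\<in>set us. lift t w) = (\<Sum>a = 0..<length us. t $ a)"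
      unfolding sum_nth_distinct[OF us(1), symmetric] lift_def using extend_nth[OF us(1) sub] by simp
    also have "lift t r = - (\<Sum>a = 0..<length us. t $ a)" using r us(2) unfolding lift_def extend_def by simp
    finally show ?thesis by simp
  qed
  have eq_iff: "Prin G #>\<^bsub>?Z\<^esub> x = Prin G #>\<^bsub>?Z\<^esub> y \<longleftrightarrow>
      (\<exists>z\<in>carrier_vec (length us). coords us x = coords us y + ?M *\<^sub>v z)"
    if x: "x \<in> ?V \<rightarrow>\<^sub>E UNIV" "deg ?V x = 0" and y: "y \<in> ?V \<rightarrow>\<^sub>E UNIV" "deg ?V y = 0" for x y
  proof -
    let ?d = "\<lambda>v\<in>?V. x v - y v"
    have d: "x \<otimes>\<^bsub>?Z\<^esub> inv\<^bsub>?Z\<^esub> y = ?d" using y(1) by (auto simp: inv_int_lattice)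
    have "deg ?V ?d = 0" using x y unfolding deg_def by (simp add: sum_subtractf)
    then have "?d \<in> Prin G \<longleftrightarrow> (\<exists>z\<in>carrier_vec (length us). coords us ?d = ?M *\<^sub>v z)"
      by (intro Prin_iff_coords[OF G r us]) auto
    moreover have "coords us ?d = w \<longleftrightarrow> coords us x = coords us y + w" if "w \<in> carrier_vec (length us)" for w
      using that nth_mem[of _ us] sub by (auto simp: coords_def vec_eq_iff subset_iff)
    moreover have "?M *\<^sub>v z \<in> carrier_vec (length us)" if "z \<in> carrier_vec (length us)" for z
      using M that by simp
    ultimately show ?thesis using N.rcos_eq_iff[of x y] x y unfolding d by auto
  qed
  have tors: "carrier (tors (?Z Mod Prin G)) = (\<lambda>x. Prin G #>\<^bsub>?Z\<^esub> x) ` {x \<in> ?V \<rightarrow>\<^sub>E UNIV. deg ?V x = 0}"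
    unfolding N.carrier_tors_Mod nat_pow_int_lattice carrier_int_lattice
    using multiple_in_Prin_iff_deg[OF G r us det] by (intro arg_cong2[of _ _ _ _ "(`)"] refl) blast
  have "bij_betw (\<lambda>t. Prin G #>\<^bsub>?Z\<^esub> lift t) T (carrier (tors (?Z Mod Prin G)))"
  proof (rule bij_betw_imageI)
    show "inj_on (\<lambda>t. Prin G #>\<^bsub>?Z\<^esub> lift t) T"
    proof (rule inj_onI)
      fix t t' assume t: "t \<in> T" "t' \<in> T" and eq: "Prin G #>\<^bsub>?Z\<^esub> lift t = Prin G #>\<^bsub>?Z\<^esub> lift t'"
      obtain z where z: "z \<in> carrier_vec (length us)" "coords us (lift t) = coords us (lift t') + ?M *\<^sub>v z"
        using eq unfolding eq_iff[OF lift_c lift_deg lift_c lift_deg] by (rule bexE)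
      have z: "z \<in> carrier_vec (length us)" "t = t' + ?M *\<^sub>v z"
        using z lift_coords[OF subsetD[OF Tc t(1)]] lift_coords[OF subsetD[OF Tc t(2)]] by simp_all
      have "t + ?M *\<^sub>v 0\<^sub>v (length us) = t' + ?M *\<^sub>v z" using z M t Tc by auto
      then show "t = t'" by (rule transversal_unique[OF T(3) M t _ z(1), rotated]) simp
    qed
    show "(\<lambda>t. Prin G #>\<^bsub>?Z\<^esub> lift t) ` T = carrier (tors (?Z Mod Prin G))"
    proof (intro equalityI subsetI)
      fix X assume "X \<in> (\<lambda>t. Prin G #>\<^bsub>?Z\<^esub> lift t) ` T"
      then show "X \<in> carrier (tors (?Z Mod Prin G))" unfolding tors using lift_c lift_deg by blast
    next
      fix X assume "X \<in> carrier (tors (?Z Mod Prin G))"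
      then obtain x where x: "x \<in> ?V \<rightarrow>\<^sub>E UNIV" "deg ?V x = 0" and X: "X = Prin G #>\<^bsub>?Z\<^esub> x"
        unfolding tors by blast
      obtain t z where t: "t \<in> T" and z: "z \<in> carrier_vec (length us)" "coords us x = t + ?M *\<^sub>v z"
        by (rule transversal_exists[OF T(3) M coords_carrier])
      have "Prin G #>\<^bsub>?Z\<^esub> x = Prin G #>\<^bsub>?Z\<^esub> lift t"
        unfolding eq_iff[OF x lift_c lift_deg] lift_coords[OF subsetD[OF Tc t]] using z by (rule bexI[rotated])
      then show "X \<in> (\<lambda>t. Prin G #>\<^bsub>?Z\<^esub> lift t) ` T" using t X by blast
    qed
  qed
  then have "card T = Coset.order (tors (?Z Mod Prin G))" unfolding Coset.order_def by (rule bij_betw_same_card)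
  then show ?thesis using T(2) det by simp
qed

section \<open>Duality\<close>

lemma group_dual_group: 
  assumes "group A"
  shows "group (dual_group A)"
proof -
  interpret group A by fact
  show ?thesis
  proof (rule groupI)
    show "x \<otimes>\<^bsub>dual_group A\<^esub> y \<in> carrier (dual_group A)"
      if "x \<in> carrier (dual_group A)" "y \<in> carrier (dual_group A)" for x y
      using that by (auto simp: dual_group_def hom_def)
    show "\<one>\<^bsub>dual_group A\<^esub> \<in> carrier (dual_group A)" by (auto simp: dual_group_def hom_def)
    show "x \<otimes>\<^bsub>dual_group A\<^esub> y \<otimes>\<^bsub>dual_group A\<^esub> z = x \<otimes>\<^bsub>dual_group A\<^esub> (y \<otimes>\<^bsub>dual_group A\<^esub> z)" for x y z
      by (auto simp: dual_group_def fun_eq_iff)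
    show "\<one>\<^bsub>dual_group A\<^esub> \<otimes>\<^bsub>dual_group A\<^esub> x = x" if "x \<in> carrier (dual_group A)" for x
      using that by (auto simp: dual_group_def fun_eq_iff extensional_def)
    show "\<exists>y\<in>carrier (dual_group A). y \<otimes>\<^bsub>dual_group A\<^esub> x = \<one>\<^bsub>dual_group A\<^esub>"
      if "x \<in> carrier (dual_group A)" for x
      using that by (intro bexI[of _ "\<lambda>a\<in>carrier A. - x a"]) (auto simp: dual_group_def fun_eq_iff hom_def)
  qed
qed

definition pairing :: "'s set \<Rightarrow> ('s \<Rightarrow> int) \<Rightarrow> ('s \<Rightarrow> int) \<Rightarrow> int" where
  "pairing S y = (\<lambda>x\<in>S \<rightarrow>\<^sub>E UNIV. \<Sum>s\<in>S. y s * x s)"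

text \<open>
  A homomorphism out of \<open>\<int>\<^sup>S\<close> is determined by its values on the basis: add the coordinates of \<open>x\<close> one at
  a time.
\<close>

lemma hom_int_lattice_eq_pairing:
  assumes S: "finite S" and f: "f \<in> hom (int_lattice S) integer_group" and x: "x \<in> S \<rightarrow>\<^sub>E UNIV"
  shows "f x = (\<Sum>s\<in>S. f (basis_vec S s) * x s)"
proof -
  interpret Z: comm_group "int_lattice S" by (rule comm_group_int_lattice)
  interpret f: group_hom "int_lattice S" integer_group f
    by (intro group_hom.intro group_hom_axioms.intro f Z.is_group group_integer_group)
  have basis: "basis_vec S s \<in> carrier (int_lattice S)" for s by (simp add: basis_vec_def)
  have pow: "y [^]\<^bsub>int_lattice S\<^esub> (k :: int) = (\<lambda>s\<in>S. k * y s)" if "y \<in> carrier (int_lattice S)" for y k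
  proof (cases "k \<ge> 0")
    case True
    then show ?thesis by (simp add: int_pow_def2 nat_pow_int_lattice)
  next
    case False
    then show ?thesis by (auto simp: int_pow_def2 nat_pow_int_lattice inv_int_lattice fun_eq_iff)
  qed
  have part: "f (\<lambda>s\<in>S. if s \<in> A then x s else 0) = (\<Sum>s\<in>A. f (basis_vec S s) * x s)"
    if "A \<subseteq> S" for A
    using finite_subset[OF that S] that
  proof (induction A rule: finite_induct)
    case empty
    have "(\<lambda>s\<in>S. 0) = \<one>\<^bsub>int_lattice S\<^esub>" by (simp add: int_lattice_def)
    then show ?case using f.hom_one by simp
  next
    case (insert a A)
    have "(\<lambda>s\<in>S. if s \<in> insert a A then x s else 0) =
        (\<lambda>s\<in>S. if s \<in> A then x s else 0) \<otimes>\<^bsub>int_lattice S\<^esub> (basis_vec S a [^]\<^bsub>int_lattice S\<^esub> x a)"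
      unfolding pow[OF basis] using insert.hyps by (auto simp: fun_eq_iff basis_vec_def)
    then have "f (\<lambda>s\<in>S. if s \<in> insert a A then x s else 0) =
        f (\<lambda>s\<in>S. if s \<in> A then x s else 0) + f (basis_vec S a) * x a"
      using f.hom_mult[of "\<lambda>s\<in>S. if s \<in> A then x s else 0" "basis_vec S a [^]\<^bsub>int_lattice S\<^esub> x a"]
        f.hom_int_pow[OF basis, of a "x a"] Z.int_pow_closed[OF basis, of a "x a"] by (simp add: mult.commute)
    also have "f (\<lambda>s\<in>S. if s \<in> A then x s else 0) = (\<Sum>s\<in>A. f (basis_vec S s) * x s)"
      using insert.IH insert.prems by blast
    also have "\<dots> + f (basis_vec S a) * x a = (\<Sum>s\<in>insert a A. f (basis_vec S s) * x s)"
      using insert.hyps by simp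
    finally show ?case .
  qed
  have "(\<lambda>s\<in>S. if s \<in> S then x s else 0) = x" using x by (auto simp: fun_eq_iff PiE_def extensional_def)
  then show ?thesis using part[of S] by simp
qed

lemma pairing_iso:
  assumes S: "finite S"
  shows "pairing S \<in> iso (int_lattice S) (dual_group (int_lattice S))"
proof (rule isoI)
  show "pairing S \<in> hom (int_lattice S) (dual_group (int_lattice S))"
  proof (rule homI)
    show "pairing S y \<in> carrier (dual_group (int_lattice S))" for y
      by (auto simp: dual_group_def pairing_def hom_def sum.distrib distrib_left)
    show "pairing S (y \<otimes>\<^bsub>int_lattice S\<^esub> z) = pairing S y \<otimes>\<^bsub>dual_group (int_lattice S)\<^esub> pairing S z" for y z
      by (auto simp: dual_group_def pairing_def sum.distrib distrib_right fun_eq_iff)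
  qed
  have basis: "basis_vec S s \<in> S \<rightarrow>\<^sub>E UNIV" for s by (simp add: basis_vec_def)
  show "bij_betw (pairing S) (carrier (int_lattice S)) (carrier (dual_group (int_lattice S)))"
  proof (rule bij_betw_imageI)
    show "inj_on (pairing S) (carrier (int_lattice S))"
    proof (rule inj_onI)
      fix y z assume yz: "y \<in> carrier (int_lattice S)" "z \<in> carrier (int_lattice S)" "pairing S y = pairing S z"
      have "y s = pairing S y (basis_vec S s)" if "s \<in> S" for s y
      proof -
        have "(\<Sum>t\<in>S. y t * basis_vec S s t) = (\<Sum>t\<in>S. if t = s then y t else 0)"
          by (intro sum.cong) (auto simp: basis_vec_def)
        then show ?thesis using that S basis by (simp add: pairing_def)
      qed
      then have "y s = z s" if "s \<in> S" for s using that yz(3) by metis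
      then show "y = z" using yz(1,2) by (intro PiE_ext[of y S _ z]) auto
    qed
    show "pairing S ` carrier (int_lattice S) = carrier (dual_group (int_lattice S))"
    proof (intro equalityI subsetI)
      fix f assume "f \<in> pairing S ` carrier (int_lattice S)"
      then show "f \<in> carrier (dual_group (int_lattice S))"
        by (auto simp: dual_group_def pairing_def hom_def sum.distrib distrib_left)
    next
      fix f assume "f \<in> carrier (dual_group (int_lattice S))"
      then have f: "f \<in> hom (int_lattice S) integer_group" "f \<in> extensional (S \<rightarrow>\<^sub>E UNIV)"
        unfolding dual_group_def by auto
      have "f = pairing S (\<lambda>s\<in>S. f (basis_vec S s))"
      proof (rule extensionalityI[OF f(2)])
        show "pairing S (\<lambda>s\<in>S. f (basis_vec S s)) \<in> extensional (S \<rightarrow>\<^sub>E UNIV)" by (simp add: pairing_def)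
        show "f x = pairing S (\<lambda>s\<in>S. f (basis_vec S s)) x" if "x \<in> S \<rightarrow>\<^sub>E UNIV" for x
          using hom_int_lattice_eq_pairing[OF S f(1) that] that by (simp add: pairing_def)
      qed
      then show "f \<in> pairing S ` carrier (int_lattice S)" by (intro image_eqI) auto
    qed
  qed
qed

lemma Mod_iso:
  assumes h: "h \<in> iso A B" and A: "group A" and B: "group B" and N: "N \<lhd> A"
  shows "A Mod N \<cong> B Mod (h ` N)"
proof -
  interpret N: normal N A by fact
  have hh: "h \<in> hom A B" "inj_on h (carrier A)" "h ` carrier A = carrier B"
    using h unfolding iso_def bij_betw_def by auto
  interpret h: group_hom A B h using A B hh(1) by (intro group_hom.intro group_hom_axioms.intro)
  have M: "h ` N \<lhd> B" by (rule iso_normal_subgroup[OF h A B N])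
  interpret M: normal "h ` N" B by (rule M)
  let ?g = "\<lambda>x. h ` N #>\<^bsub>B\<^esub> h x"
  have "?g \<in> hom A (B Mod h ` N)"
    using hom_compose[OF hh(1) M.r_coset_hom_Mod] by (simp add: o_def)
  then interpret g: group_hom A "B Mod h ` N" ?g
    by (intro group_hom.intro group_hom_axioms.intro A M.factorgroup_is_group)
  have "?g ` carrier A = carrier (B Mod h ` N)" unfolding carrier_FactGroup hh(3)[symmetric] by blast
  then have "A Mod kernel A (B Mod h ` N) ?g \<cong> B Mod h ` N" by (rule g.FactGroup_iso)
  moreover have "kernel A (B Mod h ` N) ?g = N"
  proof (intro equalityI subsetI)
    fix x assume "x \<in> kernel A (B Mod h ` N) ?g"
    then have x: "x \<in> carrier A" "h ` N #>\<^bsub>B\<^esub> h x = h ` N" unfolding kernel_def by auto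
    then have "h x \<in> h ` N" using group.rcos_self[OF B _ M.is_subgroup, of "h x"] by auto
    then obtain z where z: "z \<in> N" "h x = h z" by blast
    then have "x = z" using inj_onD[OF hh(2)] x(1) N.subset by blast
    then show "x \<in> N" using z(1) by simp
  next
    fix x assume x: "x \<in> N"
    then have xA: "x \<in> carrier A" using N.subset by blast
    have "h ` N #>\<^bsub>B\<^esub> h x = h ` N"
      by (rule group.coset_join2[OF B h.hom_closed[OF xA] M.is_subgroup imageI[OF x]])
    then show "x \<in> kernel A (B Mod h ` N) ?g" using xA unfolding kernel_def by simp
  qed
  ultimately show ?thesis by simp
qed

lemma tors_iso:
  assumes A: "group A" and B: "group B" and iso: "A \<cong> B"
  shows "tors A \<cong> tors B"
proof -
  obtain h where h: "h \<in> iso A B" using iso unfolding is_iso_def by blast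
  then have hom: "h \<in> hom A B" and inj: "inj_on h (carrier A)" and surj: "h ` carrier A = carrier B"
    unfolding iso_def bij_betw_def by auto
  interpret h: group_hom A B h using A B hom by (intro group_hom.intro group_hom_axioms.intro)
  have tor: "x [^]\<^bsub>A\<^esub> n = \<one>\<^bsub>A\<^esub> \<longleftrightarrow> h x [^]\<^bsub>B\<^esub> n = \<one>\<^bsub>B\<^esub>" if x: "x \<in> carrier A" for x and n :: nat
  proof -
    have "h (x [^]\<^bsub>A\<^esub> n) = h \<one>\<^bsub>A\<^esub> \<longleftrightarrow> x [^]\<^bsub>A\<^esub> n = \<one>\<^bsub>A\<^esub>" using inj x by (intro inj_on_eq_iff) auto
    then show ?thesis using h.hom_nat_pow[OF x, of n] by auto
  qed
  have "h \<in> iso (tors A) (tors B)"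
  proof (rule isoI)
    show "h \<in> hom (tors A) (tors B)"
      by (rule homI) (use tor in \<open>auto simp: tors_def\<close>)
    show "bij_betw h (carrier (tors A)) (carrier (tors B))"
    proof (rule bij_betw_imageI)
      show "inj_on h (carrier (tors A))" by (rule inj_on_subset[OF inj]) (auto simp: tors_def)
      show "h ` carrier (tors A) = carrier (tors B)"
      proof (intro equalityI subsetI)
        fix y assume "y \<in> h ` carrier (tors A)"
        then show "y \<in> carrier (tors B)" using tor unfolding tors_def by auto
      next
        fix y assume "y \<in> carrier (tors B)"
        then obtain n where y: "y \<in> carrier B" "(n :: nat) > 0" "y [^]\<^bsub>B\<^esub> n = \<one>\<^bsub>B\<^esub>"
          unfolding tors_def by auto
        then obtain x where x: "x \<in> carrier A" "y = h x" using surj by blast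
        then have "x \<in> carrier (tors A)" using y tor[OF x(1), of n] unfolding tors_def by auto
        then show "y \<in> h ` carrier (tors A)" using x(2) by blast
      qed
    qed
  qed
  then show ?thesis by (rule is_isoI)
qed

text \<open>
  The \<open>\<int>\<close> summand of the middle term contributes nothing, because the first differential is zero there.
  On \<open>\<int>\<^sup>V\<close>, composing a functional with the Laplacian is, by self-adjointness, applying the Laplacian to
  the vector that represents the functional.
\<close>

lemma coboundaries_D_Cone_laplacian:
  assumes G: "fin_digraph G"
  shows "diff_0 (D (Cone_laplacian G)) ` carrier (term_0 (D (Cone_laplacian G))) = pairing (verts G) ` Prin G"
proof -
  let ?V = "verts G" and ?Z = "int_lattice (verts G)"
  have fin: "finite ?V" by (rule fin_digraph.finite_verts[OF G])
  have adj: "compose (?V \<rightarrow>\<^sub>E UNIV) (pairing ?V y) (laplacian G) = pairing ?V (laplacian G y)" for y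
    unfolding compose_def pairing_def
    using laplacian_in_carrier[of G] laplacian_self_adjoint[OF G, of y] by (auto simp: fun_eq_iff)
  have diff: "diff_0 (D (Cone_laplacian G)) f = compose (?V \<rightarrow>\<^sub>E UNIV) f (\<lambda>x. (laplacian G x, 0))" for f
    by (simp add: D_def Cone_def)
  have car: "carrier (term_0 (D (Cone_laplacian G))) = carrier (dual_group (?Z \<times>\<times> integer_group))"
    by (simp add: D_def Cone_def)
  show ?thesis
  proof (intro equalityI subsetI)
    fix g assume "g \<in> diff_0 (D (Cone_laplacian G)) ` carrier (term_0 (D (Cone_laplacian G)))"
    then obtain f where f: "f \<in> hom (?Z \<times>\<times> integer_group) integer_group"
      and g: "g = compose (?V \<rightarrow>\<^sub>E UNIV) f (\<lambda>x. (laplacian G x, 0))"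
      unfolding car diff by (auto simp: dual_group_def)
    have "f (x \<otimes>\<^bsub>?Z\<^esub> y, 0) = f (x, 0) + f (y, 0)" if "x \<in> ?V \<rightarrow>\<^sub>E UNIV" "y \<in> ?V \<rightarrow>\<^sub>E UNIV" for x y
      using hom_mult[OF f, of "(x, 0)" "(y, 0)"] that by simp
    then have "(\<lambda>x\<in>?V \<rightarrow>\<^sub>E UNIV. f (x, 0)) \<in> carrier (dual_group ?Z)"
      by (auto simp: dual_group_def hom_def)
    then obtain y where y: "y \<in> ?V \<rightarrow>\<^sub>E UNIV" "(\<lambda>x\<in>?V \<rightarrow>\<^sub>E UNIV. f (x, 0)) = pairing ?V y"
      using pairing_iso[OF fin] unfolding iso_def bij_betw_def by auto
    have "g = compose (?V \<rightarrow>\<^sub>E UNIV) (pairing ?V y) (laplacian G)"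
      unfolding g y(2)[symmetric] compose_def using laplacian_in_carrier[of G] by (auto simp: fun_eq_iff)
    then show "g \<in> pairing ?V ` Prin G" unfolding adj Prin_def using y(1) by auto
  next
    fix g assume "g \<in> pairing ?V ` Prin G"
    then obtain y where y: "y \<in> ?V \<rightarrow>\<^sub>E UNIV" and g: "g = pairing ?V (laplacian G y)"
      unfolding Prin_def by auto
    let ?f = "\<lambda>(x, n)\<in>carrier (?Z \<times>\<times> integer_group). pairing ?V y x"
    have "?f \<in> carrier (dual_group (?Z \<times>\<times> integer_group))"
      by (auto simp: dual_group_def hom_def pairing_def sum.distrib distrib_left)
    moreover have "g = compose (?V \<rightarrow>\<^sub>E UNIV) ?f (\<lambda>x. (laplacian G x, 0))"
      unfolding g adj[symmetric] compose_def using laplacian_in_carrier[of G] by (auto simp: fun_eq_iff)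
    ultimately show "g \<in> diff_0 (D (Cone_laplacian G)) ` carrier (term_0 (D (Cone_laplacian G)))"
      unfolding car diff by blast
  qed
qed

text \<open>
  The pairing is an isomorphism of \<open>\<int>\<^sup>V\<close> with its dual that carries \<open>Prin G\<close> onto the coboundaries, so
  it descends to the quotients.
\<close>

lemma Jac_iso_H1_D_Cone_laplacian:
  assumes G: "fin_digraph G"
  shows "group (Jac G)" "group (H1 (D (Cone_laplacian G)))" "Jac G \<cong> H1 (D (Cone_laplacian G))"
proof -
  let ?Z = "int_lattice (verts G)"
  interpret Z: comm_group ?Z by (rule comm_group_int_lattice)
  interpret N: normal "Prin G" ?Z by (rule Prin_normal[OF G])
  have iso: "pairing (verts G) \<in> iso ?Z (dual_group ?Z)"
    by (rule pairing_iso[OF fin_digraph.finite_verts[OF G]])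
  have dual: "group (dual_group ?Z)" by (rule group_dual_group[OF Z.is_group])
  have H1: "H1 (D (Cone_laplacian G)) = dual_group ?Z Mod (pairing (verts G) ` Prin G)"
    unfolding H1_def coboundaries_D_Cone_laplacian[OF G] by (simp add: D_def Cone_def)
  show "group (Jac G)" unfolding Jac_def Div_def by (rule N.factorgroup_is_group)
  show "group (H1 (D (Cone_laplacian G)))" unfolding H1
    by (rule normal.factorgroup_is_group[OF iso_normal_subgroup[OF iso Z.is_group dual N.normal_axioms]])
  show "Jac G \<cong> H1 (D (Cone_laplacian G))" unfolding H1 Jac_def Div_def
    by (rule Mod_iso[OF iso Z.is_group dual N.normal_axioms])
qed

section \<open>The number of spanning trees\<close>

lemma card_parent_maps:
  assumes "fin_digraph G" "r \<in> verts G"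
  shows "card (parent_maps G r) = num_spanning_trees G"
  unfolding num_spanning_trees_def
  by (rule bij_betw_same_card[OF bij_betw_parent_maps_spanning_trees[OF assms]])

lemma num_spanning_trees_pos:
  assumes G: "fin_digraph G" and conn: "connected G"
  shows "num_spanning_trees G > 0"
proof -
  interpret fin_digraph G by fact
  obtain r where r: "r \<in> verts G" and reach: "\<forall>u\<in>verts G. (u, r) \<in> (step_rel G (arcs G))\<^sup>*"
    using conn unfolding connected_iff_step_rel[OF wf_digraph_axioms] by blast
  have "parent_maps G r \<noteq> {}" using connected_has_parent_map[OF reach] by blast
  moreover have "finite (parent_maps G r)"
    using finite_step_choices[OF G] unfolding parent_maps_def by simp
  ultimately show ?thesis unfolding card_parent_maps[OF G r, symmetric] by (simp add: card_gt_0_iff)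
qed

lemma det_principal_laplacian_mat_eq_num_spanning_trees:
  assumes "fin_digraph G" "r \<in> verts G" "distinct us" "set us = verts G - {r}"
  shows "det (principal_laplacian_mat G us) = int (num_spanning_trees G)"
  using det_principal_laplacian_mat[OF assms] card_parent_maps[OF assms(1,2)] by simp

lemma order_tors_Jac:
  assumes G: "fin_digraph G" and conn: "connected G"
  shows "Coset.order (tors (Jac G)) = num_spanning_trees G"
proof -
  interpret fin_digraph G by fact
  obtain r where r: "r \<in> verts G" using conn unfolding connected_iff_step_rel[OF wf_digraph_axioms] by blast
  obtain us where us: "distinct us" "set us = verts G - {r}"
    using finite_distinct_list[of "verts G - {r}"] by auto
  note det = det_principal_laplacian_mat_eq_num_spanning_trees[OF G r us]
  then show ?thesis
    using order_tors_coker_laplacian[OF G r us] num_spanning_trees_pos[OF G conn] unfolding Jac_def Div_def by simp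
qed

lemma is_iso_imp_order_eq: "A \<cong> B \<Longrightarrow> Coset.order A = Coset.order B"
  unfolding is_iso_def iso_def Coset.order_def by (auto dest: bij_betw_same_card)

theorem theorem6p34:
  fixes G :: "('a, 'b) pre_digraph"
  assumes "fin_digraph G" and "connected G"
  shows "tors (H1 (D (Cone_laplacian G))) \<cong> tors (Jac G)
     \<and> Coset.order (tors (H1 (D (Cone_laplacian G)))) = num_spanning_trees G
     \<and> Coset.order (tors (Jac G)) =
         Coset.order (tors (coker (int_lattice (verts G)) (int_lattice (verts G)) (laplacian G)))
     \<and> (\<forall>vs i. distinct vs \<and> set vs = verts G \<and> i < length vs \<longrightarrow>
           int (Coset.order
             (tors (coker (int_lattice (verts G)) (int_lattice (verts G)) (laplacian G)))) =
             det (reduced_laplacian_mat G vs i)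
         \<and> det (reduced_laplacian_mat G vs i) = int (num_spanning_trees G))"
proof (intro conjI allI impI)
  let ?tau = "num_spanning_trees G"
  have coker: "coker (int_lattice (verts G)) (int_lattice (verts G)) (laplacian G) = Jac G"
    unfolding coker_def Jac_def Div_def Prin_def ..
  have jac: "Coset.order (tors (Jac G)) = ?tau" by (rule order_tors_Jac[OF assms])
  note H1 = Jac_iso_H1_D_Cone_laplacian[OF assms(1)]
  show iso: "tors (H1 (D (Cone_laplacian G))) \<cong> tors (Jac G)"
    by (rule tors_iso[OF H1(2,1) group.iso_sym[OF H1(1,3)]])
  show "Coset.order (tors (H1 (D (Cone_laplacian G)))) = ?tau"
    using is_iso_imp_order_eq[OF iso] jac by simp
  show "Coset.order (tors (Jac G)) =
      Coset.order (tors (coker (int_lattice (verts G)) (int_lattice (verts G)) (laplacian G)))"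
    unfolding coker ..
  fix vs i
  assume vs: "distinct vs \<and> set vs = verts G \<and> i < length vs"
  let ?us = "take i vs @ drop (Suc i) vs"
  have split: "vs = take i vs @ vs ! i # drop (Suc i) vs" using vs by (simp add: id_take_nth_drop)
  then have "distinct (take i vs @ vs ! i # drop (Suc i) vs)"
    and "set (take i vs @ vs ! i # drop (Suc i) vs) = verts G" using vs by simp_all
  then have us: "distinct ?us" "set ?us = verts G - {vs ! i}" and r: "vs ! i \<in> verts G" by auto
  have det: "det (reduced_laplacian_mat G vs i) = int ?tau"
    using reduced_laplacian_mat_eq[of i vs G] vs
      det_principal_laplacian_mat_eq_num_spanning_trees[OF assms(1) r us] by simp
  then show "det (reduced_laplacian_mat G vs i) = int ?tau" .
  show "int (Coset.order (tors (coker (int_lattice (verts G)) (int_lattice (verts G)) (laplacian G)))) =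
      det (reduced_laplacian_mat G vs i)"
    unfolding coker jac det ..
qed

end
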